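(* Let $d\ge 1$, $T\ge 1$, let $K_t^j\subseteq\mathbb R$ ($j=1,\dots,d$, $t=0,\dots,T$) be closed sets, $\Omega=\prod_{t=0}^T\prod_{j=1}^d K_t^j$, and let $\mathcal E=\mathcal E_0\times\dots\times\mathcal E_T$, $U$, $V$, $\mathcal A$, $S^U$, $\mathcal D$, $\mathfrak P$ be as in the context. Assume: (i) $U:\mathcal E\to[-\infty,+\infty)$ is concave with $U(0)\in\mathbb R$, and $\mathcal A\subseteq C_{0:T}$ is a convex cone with $0\in\mathcal A$; (ii) for every $t=0,\dots,T$ there exist compact sets $\mathfrak K_t(n)\subseteq\prod_{j=1}^dK_t^j$ and functions $0\le f_t^n\in\mathcal E_t$, $n\ge 1$, such that $1+\sum_{t=0}^T\sum_{j=1}^d|x_t^j|\le\sum_{t=0}^T f_t^n(x_0,\dots,x_t)$ for all $x\in\Omega\setminus(\mathfrak K_0(n)\times\dots\times\mathfrak K_T(n))$, and $V(\Gamma f_0^n,\dots,\Gamma f_T^n)\to 0$ as $n\to\infty$ for every real $\Gamma>0$. Then: (a) If $\mathfrak P(\widehat c)<+\infty$ for some $\widehat c\in B_{0:T}$, then $\mathfrak P(c)\in\mathbb R$ for every $c\in B_{0:T}$, and $\mathfrak P:B_{0:T}\to\mathbb R$ is norm continuous, cash additive ($\mathfrak P(c+k)=\mathfrak P(c)+k$ for $k\in\mathbb R$), concave and nondecreasing on $B_{0:T}$. (b) For every lower semicontinuous $c:\Omega\to(-\infty,+\infty]$ such that $c(x)\ge -A\big(1+\sum_{t=0}^T\sum_{j=1}^d|x_t^j|\big)$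 for all $x\in\Omega$ and some $A\in[0,+\infty)$, we have $$\mathfrak P(c)=\inf_{Q\in\mathrm{Prob}^1(\Omega)\cap\mathcal A^\circ}\big(E_Q[c]+\mathcal D(Q)\big),$$ (with $\inf\emptyset=+\infty$), where $\mathcal D(Q)=\sup_{\varphi\in\mathcal E}\big(U(\varphi)-\sum_{t=0}^T\int_{\Omega_{0:t}}\varphi_t\,dQ_t\big)=\sup_{\varphi\in\mathcal E}\big(\sum_{t=0}^T\int_{\Omega_{0:t}}\varphi_t\,dQ_t-V(\varphi)\big)$. Furthermore, if $\mathfrak P(c)<+\infty$ the infimum is a minimum.
   Context: For $0\le t\le T$, $\Omega_{0:t}=\prod_{s=0}^t\prod_{j=1}^dK_s^j$; points $x=(x_0,\dots,x_T)\in\Omega$ with $x_t=(x_t^1,\dots,x_t^d)$. $C_{0:t}$ is the space of continuous $\phi:\Omega_{0:t}\to\mathbb R$ with $\|\phi\|_{0:t}:=\sup_{x}\frac{|\phi(x)|}{1+\sum_{s=0}^t\sum_{j=1}^d|x_s^j|}<\infty$; elements of $C_{0:t}$ are also regarded as functions on $\Omega$ depending only on $(x_0,\dots,x_t)$. $B_{0:T}$ is defined as $C_{0:T}$ but with Borel measurable instead of continuous functions, normed by $\|\cdot\|_{0:T}$. $(C_{0:T})^*$ is the topological dual of $C_{0:T}$. $\mathrm{Prob}^1(\Omega)$ is the set of Borel probability measures $Q$ on $\Omega$ with $\int|x_t^j|\,dQ<\infty$ for all $j,t$; such $Q$ is identified with the functional $c\mapsto E_Q[c]$ on $C_{0:T}$,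 and $Q_t$ is its marginal on $\Omega_{0:t}$. $\mathcal E_t$ are vector subspaces with $\mathbb R\subseteq\mathcal E_t\subseteq C_{0:t}$, $\mathcal E=\mathcal E_0\times\dots\times\mathcal E_T$, $U:\mathcal E\to[-\infty,+\infty)$, $V(\varphi):=-U(-\varphi)$. $S^U(\varphi):=\sup_{\beta\in\mathbb R^{T+1}}\big(U(\varphi+\beta)-\sum_{t=0}^T\beta_t\big)$ (componentwise addition) and $\mathrm{dom}(S^U)=\{\varphi\in\mathcal E:S^U(\varphi)>-\infty\}$. The polar of $\mathcal A$ is $\mathcal A^\circ=\{\lambda\in(C_{0:T})^*:\langle z,\lambda\rangle\le 0\ \forall z\in\mathcal A\}$; thus $Q\in\mathrm{Prob}^1(\Omega)\cap\mathcal A^\circ$ means $E_Q[z]\le0$ for all $z\in\mathcal A$. For measurable $c$ and $z\in-\mathcal A$, $\Phi_z(c)=\{\varphi\in\mathrm{dom}(S^U):\sum_{t=0}^T\varphi_t(x_0,\dots,x_t)+z(x)\le c(x)\ \forall x\in\Omega\}$ and $\mathfrak P(c)=\sup_{z\in-\mathcal A}\sup_{\varphi\in\Phi_z(c)}S^U(\varphi)\in[-\infty,+\infty]$, with $\sup\emptyset=-\infty$. *)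

theory Defs
  imports "HOL-Probability.Probability"
begin

text \<open>Points x = (x_0,...,x_T) with x_t in R^d are encoded as functions
  x :: nat \<times> nat \<Rightarrow> real, x (t,j) = x_t^j, for t \<le> T and j \<in> {1..d};
  all other coordinates are 0.  The space carries the (product) topology of the
  function type; on Omega it coincides with the Euclidean one.\<close>

type_synonym pt = "nat \<times> nat \<Rightarrow> real"
type_synonym fn = "pt \<Rightarrow> real"

definition Omega :: "nat \<Rightarrow> nat \<Rightarrow> (nat \<Rightarrow> nat \<Rightarrow> real set) \<Rightarrow> pt set" where
  "Omega d T K = {x. (\<forall>t\<le>T. \<forall>j\<in>{1..d}. x (t,j) \<in> K t j) \<and>
                     (\<forall>t j. (T < t \<or> j \<notin> {1..d}) \<longrightarrow> x (t,j) = 0)}"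

definition absum :: "nat \<Rightarrow> nat \<Rightarrow> pt \<Rightarrow> real" where
  "absum d t x = (\<Sum>s\<le>t. \<Sum>j=1..d. \<bar>x (s,j)\<bar>)"

text \<open>Functions on Omega are represented by functions on the whole type that vanish
  off Omega (so that functions equal on Omega are equal).  The constant k on Omega:\<close>
definition cst :: "pt set \<Rightarrow> real \<Rightarrow> fn" where
  "cst Om k = (\<lambda>x. if x \<in> Om then k else 0)"

definition Cspace :: "nat \<Rightarrow> nat \<Rightarrow> (nat \<Rightarrow> nat \<Rightarrow> real set) \<Rightarrow> nat \<Rightarrow> fn set" where
  "Cspace d T K t = {\<phi>. continuous_on (Omega d T K) \<phi> \<and>
      (\<forall>x. x \<notin> Omega d T K \<longrightarrow> \<phi> x = 0) \<and>
      (\<forall>x\<in>Omega d T K. \<forall>y\<in>Omega d T K.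
          (\<forall>s\<le>t. \<forall>j\<in>{1..d}. x (s,j) = y (s,j)) \<longrightarrow> \<phi> x = \<phi> y) \<and>
      (\<exists>M. \<forall>x\<in>Omega d T K. \<bar>\<phi> x\<bar> \<le> M * (1 + absum d t x))}"

definition normB :: "nat \<Rightarrow> nat \<Rightarrow> (nat \<Rightarrow> nat \<Rightarrow> real set) \<Rightarrow> fn \<Rightarrow> ereal" where
  "normB d T K c = (SUP x\<in>Omega d T K. ereal (\<bar>c x\<bar> / (1 + absum d T x)))"

text \<open>B_{0:T}: Borel measurable functions on Omega with finite norm (values off
  Omega are irrelevant).\<close>
definition Bspace :: "nat \<Rightarrow> nat \<Rightarrow> (nat \<Rightarrow> nat \<Rightarrow> real set) \<Rightarrow> fn set" where
  "Bspace d T K = {c. c \<in> borel_measurable (restrict_space borel (Omega d T K)) \<and>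
                      normB d T K c < \<infinity>}"

definition Ecal :: "nat \<Rightarrow> (nat \<Rightarrow> fn set) \<Rightarrow> (nat \<Rightarrow> fn) set" where
  "Ecal T E = {\<phi>. (\<forall>t\<le>T. \<phi> t \<in> E t) \<and> (\<forall>t>T. \<phi> t = (\<lambda>x. 0))}"

definition shift :: "nat \<Rightarrow> pt set \<Rightarrow> (nat \<Rightarrow> fn) \<Rightarrow> (nat \<Rightarrow> real) \<Rightarrow> (nat \<Rightarrow> fn)" where
  "shift T Om \<phi> \<beta> = (\<lambda>t. if t \<le> T then (\<lambda>x. \<phi> t x + cst Om (\<beta> t) x) else (\<lambda>x. 0))"

definition Vfun :: "((nat \<Rightarrow> fn) \<Rightarrow> ereal) \<Rightarrow> (nat \<Rightarrow> fn) \<Rightarrow> ereal" where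
  "Vfun U \<phi> = - U (\<lambda>t x. - \<phi> t x)"

definition SU :: "nat \<Rightarrow> pt set \<Rightarrow> ((nat \<Rightarrow> fn) \<Rightarrow> ereal) \<Rightarrow> (nat \<Rightarrow> fn) \<Rightarrow> ereal" where
  "SU T Om U \<phi> = (SUP \<beta>\<in>(UNIV :: (nat \<Rightarrow> real) set).
                     U (shift T Om \<phi> \<beta>) - ereal (\<Sum>t\<le>T. \<beta> t))"

definition domSU :: "nat \<Rightarrow> pt set \<Rightarrow> (nat \<Rightarrow> fn set) \<Rightarrow> ((nat \<Rightarrow> fn) \<Rightarrow> ereal)
                      \<Rightarrow> (nat \<Rightarrow> fn) set" where
  "domSU T Om E U = {\<phi> \<in> Ecal T E. SU T Om U \<phi> > -\<infinity>}"

definition Phi :: "nat \<Rightarrow> pt set \<Rightarrow> (nat \<Rightarrow> fn set) \<Rightarrow> ((nat \<Rightarrow> fn) \<Rightarrow> ereal)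
                    \<Rightarrow> fn \<Rightarrow> (pt \<Rightarrow> ereal) \<Rightarrow> (nat \<Rightarrow> fn) set" where
  "Phi T Om E U z c = {\<phi> \<in> domSU T Om E U.
       \<forall>x\<in>Om. ereal ((\<Sum>t\<le>T. \<phi> t x) + z x) \<le> c x}"

definition Pfrak :: "nat \<Rightarrow> pt set \<Rightarrow> (nat \<Rightarrow> fn set) \<Rightarrow> ((nat \<Rightarrow> fn) \<Rightarrow> ereal)
                     \<Rightarrow> fn set \<Rightarrow> (pt \<Rightarrow> ereal) \<Rightarrow> ereal" where
  "Pfrak T Om E U A c =
     (SUP z\<in>uminus ` A. SUP \<phi>\<in>Phi T Om E U z c. SU T Om U \<phi>)"

definition Prob1 :: "nat \<Rightarrow> nat \<Rightarrow> (nat \<Rightarrow> nat \<Rightarrow> real set) \<Rightarrow> pt measure set" where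
  "Prob1 d T K = {Q. prob_space Q \<and> sets Q = sets borel \<and>
       emeasure Q (Omega d T K) = 1 \<and>
       (\<forall>t\<le>T. \<forall>j\<in>{1..d}. integrable Q (\<lambda>x. x (t,j)))}"

definition polarP :: "fn set \<Rightarrow> pt measure set" where
  "polarP A = {Q. \<forall>z\<in>A. integral\<^sup>L Q z \<le> 0}"

definition ExpQ :: "pt measure \<Rightarrow> (pt \<Rightarrow> ereal) \<Rightarrow> ereal" where
  "ExpQ Q c = enn2ereal (\<integral>\<^sup>+ x. e2ennreal (c x) \<partial>Q)
            - enn2ereal (\<integral>\<^sup>+ x. e2ennreal (- c x) \<partial>Q)"

text \<open>\<D>(Q) = sup_{\<phi>\<in>\<E>} (U(\<phi>) - sum_t \<integral>\<phi>_t dQ_t); since \<phi>_t depends only on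
  (x_0..x_t), \<integral>\<phi>_t dQ_t = \<integral>\<phi>_t dQ.\<close>
definition Dcal :: "nat \<Rightarrow> (nat \<Rightarrow> fn set) \<Rightarrow> ((nat \<Rightarrow> fn) \<Rightarrow> ereal) \<Rightarrow> pt measure \<Rightarrow> ereal" where
  "Dcal T E U Q = (SUP \<phi>\<in>Ecal T E. U \<phi> - ereal (\<Sum>t\<le>T. integral\<^sup>L Q (\<phi> t)))"

definition lsc_on :: "pt set \<Rightarrow> (pt \<Rightarrow> ereal) \<Rightarrow> bool" where
  "lsc_on S c = (\<forall>x\<in>S. \<forall>y. y < c x \<longrightarrow> eventually (\<lambda>x'. y < c x') (at x within S))"

end

theory Submission
  imports Defs
begin

text \<open>
  Absorbing the shift \<open>\<beta>\<close> of \<open>S\<^sup>U\<close> into one real number, \<open>\<P>(c)\<close> is the supremum of \<open>U(\<psi>) - b\<close> over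
  \<open>\<psi> \<in> \<E>\<close>, \<open>a \<in> \<A>\<close>, \<open>b \<in> \<real>\<close> with \<open>\<Sum>\<psi>\<^sub>t - b - a \<le> c\<close>; concavity, monotonicity and cash additivity are
  then immediate, and assumption (ii) makes \<open>\<P>\<close> finite from below on functions of linear growth.

  For the duality, fix a lower semicontinuous \<open>c\<close> with \<open>\<P>(c) < \<infinity>\<close>.  The concave function
  \<open>g \<mapsto> \<P>(c + g)\<close> is finite on the whole of \<open>C\<close>, so the Hahn-Banach theorem gives a linear \<open>L\<close> with
  \<open>\<P>(c + g) \<le> \<P>(c) + L g\<close>.  Such an \<open>L\<close> is positive, normalised, nonpositive on \<open>\<A>\<close>, and satisfies
  \<open>L h + U(\<phi>) - L(\<Sum>\<phi>\<^sub>t) \<le> \<P>(c)\<close> whenever \<open>h \<le> c\<close>.  Taking \<open>\<phi> = -\<Gamma> f\<^sup>n\<close> shows \<open>L(\<Sum>f\<^sup>n\<^sub>t) \<rightarrow> 0\<close>, a tightness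
  property which together with Dini's theorem makes \<open>L\<close> a Daniell integral, hence a measure \<open>Q\<close>.
  Approximating \<open>c\<close> from below by \<open>h \<in> C\<close> yields \<open>E\<^sub>Q[c] + \<D>(Q) \<le> \<P>(c)\<close>, so \<open>Q\<close> attains the infimum.
\<close>

text \<open>The functional supplied by Hahn-Banach is purely algebraic: no topology on
  \<open>C\<close> enters, because positivity, normalisation and the sign on \<open>A\<close> are
  all read off from P(c + g) >= P(c) + k, valid whenever g >= k - a on Omega. Linearising at c
  itself, instead of treating continuous functions first and passing to a limit afterwards, makes
  one measure serve all minorants of c in \<open>C\<close> at once; attainment then needs no
  compactness of sets of measures. Finiteness of P(c + g) for every g in \<open>C\<close> takes the
  place of an interior-point condition. It holds because c is the midpoint of c + g and c - g, and
  neither value is -infinity. The obstacle is that Omega need not be compact, so a positive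
  functional could lose mass at infinity. The freedom in Gamma excludes this: U(-Gamma f^n) > -1 for
  large n bounds Gamma L(sum of the f^n_t) by a constant that does not depend on Gamma. That c may
  take the value +infinity shapes many statements: hypotheses are phrased with real minorants s <=
  c(x), and c is made nonnegative by adding M w before it is integrated.\<close>

section \<open>Hahn-Banach with a convex majorant\<close>

lemma Hahn_Banach_convex:
  fixes X :: "('a \<Rightarrow> real) set" and N :: "('a \<Rightarrow> real) \<Rightarrow> real"
  assumes zero: "(\<lambda>x. 0) \<in> X"
    and lin: "\<And>f g a b. f \<in> X \<Longrightarrow> g \<in> X \<Longrightarrow> (\<lambda>x. a * f x + b * g x) \<in> X"
    and conv: "\<And>f g l. f \<in> X \<Longrightarrow> g \<in> X \<Longrightarrow> 0 < l \<Longrightarrow> l < 1 \<Longrightarrow>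
      N (\<lambda>x. l * f x + (1 - l) * g x) \<le> l * N f + (1 - l) * N g"
    and N0: "0 \<le> N (\<lambda>x. 0)"
  obtains L where
    "\<And>f g a b. f \<in> X \<Longrightarrow> g \<in> X \<Longrightarrow> L (\<lambda>x. a * f x + b * g x) = a * L f + b * L g"
    "\<And>f. f \<in> X \<Longrightarrow> L f \<le> N f"
proof -
  \<comment> \<open>Partial functionals are encoded as linear subspaces of X x R. Being
    single-valued is not demanded, since domination by \<open>N\<close> forces it
    (\<open>M00\<close>).\<close>
  define Z where "Z = {M. M \<subseteq> X \<times> UNIV \<and> ((\<lambda>x. 0), 0) \<in> M \<and>
    (\<forall>f r h s a b. (f, r) \<in> M \<longrightarrow> (h, s) \<in> M \<longrightarrow>
      ((\<lambda>x. a * f x + b * h x), a * r + b * s) \<in> M) \<and> (\<forall>f r. (f, r) \<in> M \<longrightarrow> r \<le> N f)}"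
  have "\<exists>M\<in>Z. \<forall>Y\<in>Z. M \<subseteq> Y \<longrightarrow> Y = M"
  proof (rule subset_Zorn_nonempty)
    have "{((\<lambda>x. 0), 0)} \<in> Z"
      using zero N0 by (auto simp: Z_def)
    then show "Z \<noteq> {}" by blast
    fix C assume C: "C \<noteq> {}" "subset.chain Z C"
    have CZ: "\<And>M. M \<in> C \<Longrightarrow> M \<in> Z" and ch: "\<And>M M'. M \<in> C \<Longrightarrow> M' \<in> C \<Longrightarrow> M \<subseteq> M' \<or> M' \<subseteq> M"
      using C(2) by (auto simp: subset.chain_def)
    have *: "((\<lambda>x. a * f x + b * h x), a * r + b * s) \<in> \<Union>C"
      if fr: "(f, r) \<in> \<Union>C" and hs: "(h, s) \<in> \<Union>C" for f r h s a b
    proof -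
      obtain M where "M \<in> C" "(f, r) \<in> M" using fr by blast
      moreover obtain M' where "M' \<in> C" "(h, s) \<in> M'" using hs by blast
      ultimately obtain M'' where "M'' \<in> C" "(f, r) \<in> M''" "(h, s) \<in> M''"
        using ch[of M M'] by blast
      then show ?thesis using CZ[of M''] unfolding Z_def by blast
    qed
    have "\<Union>C \<subseteq> X \<times> UNIV" "((\<lambda>x. 0), 0) \<in> \<Union>C" "\<forall>f r. (f, r) \<in> \<Union>C \<longrightarrow> r \<le> N f"
      using CZ C(1) unfolding Z_def by blast+
    with * show "\<Union>C \<in> Z" unfolding Z_def by blast
  qed
  then obtain M where M: "M \<in> Z" and max: "\<And>Y. Y \<in> Z \<Longrightarrow> M \<subseteq> Y \<Longrightarrow> Y = M" by blast
  have MX: "\<And>f r. (f, r) \<in> M \<Longrightarrow> f \<in> X" and M0: "((\<lambda>x. 0), 0) \<in> M"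
    and Ml: "\<And>f r h s a b. (f, r) \<in> M \<Longrightarrow> (h, s) \<in> M \<Longrightarrow>
      ((\<lambda>x. a * f x + b * h x), a * r + b * s) \<in> M"
    and MN: "\<And>f r. (f, r) \<in> M \<Longrightarrow> r \<le> N f"
    using M unfolding Z_def by blast+
  have dom: "\<exists>r. (v, r) \<in> M" if v: "v \<in> X" for v
  proof -
    \<comment> \<open>A value \<alpha> at v must satisfy r + s \<alpha> <= N(m + s v) for s of
      either sign. Negative s gives the lower bounds collected in \<open>S\<close>, positive s gives
      upper bounds, and \<open>le\<close> separates the two families.\<close>
    define S where "S = {(r - N (\<lambda>x. m x - s * v x)) / s | m r s. (m, r) \<in> M \<and> 0 < s}"
    have le: "(r - N (\<lambda>x. m x - s * v x)) / s \<le> (N (\<lambda>x. m' x + s' * v x) - r') / s'"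
      if "(m, r) \<in> M" "0 < s" "(m', r') \<in> M" "0 < s'" for m r s m' r' s'
    proof -
      \<comment> \<open>\<open>N\<close> is only convex, so the two inequalities are combined with
        the weights for which l s = (1 - l) s'; then v cancels.\<close>
      define l where "l = s' / (s + s')"
      have l: "0 < l" "l < 1" "1 - l = s / (s + s')"
        using that by (auto simp: l_def field_simps)
      have X1: "(\<lambda>x. m x - s * v x) \<in> X" "(\<lambda>x. m' x + s' * v x) \<in> X"
        using lin[OF MX[OF that(1)] v, of 1 "- s"] lin[OF MX[OF that(3)] v, of 1 s'] by simp_all
      have eq: "(\<lambda>x. l * (m x - s * v x) + (1 - l) * (m' x + s' * v x)) = (\<lambda>x. l * m x + (1 - l) * m' x)"
      proof
        fix x
        have "l * s = (1 - l) * s'" unfolding l(3) by (simp add: l_def)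
        then have "l * s * v x = (1 - l) * s' * v x" by simp
        then show "l * (m x - s * v x) + (1 - l) * (m' x + s' * v x) = l * m x + (1 - l) * m' x"
          by (simp add: algebra_simps)
      qed
      have "l * r + (1 - l) * r' \<le> l * N (\<lambda>x. m x - s * v x) + (1 - l) * N (\<lambda>x. m' x + s' * v x)"
        using MN[OF Ml[OF that(1,3), of l "1 - l"]] conv[OF X1 l(1,2)] unfolding eq by linarith
      then have "(s + s') * (l * r + (1 - l) * r')
          \<le> (s + s') * (l * N (\<lambda>x. m x - s * v x) + (1 - l) * N (\<lambda>x. m' x + s' * v x))"
        using that by (intro mult_left_mono) auto
      moreover have "(s + s') * (l * p + (1 - l) * q) = s' * p + s * q" for p q
      proof -
        have "(s + s') * l = s'" "(s + s') * (1 - l) = s"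
          unfolding l(3) using that by (auto simp: l_def)
        then show ?thesis by (metis distrib_left mult.assoc)
      qed
      ultimately have "s' * r + s * r' \<le> s' * N (\<lambda>x. m x - s * v x) + s * N (\<lambda>x. m' x + s' * v x)"
        by simp
      then show ?thesis using that by (simp add: field_simps)
    qed
    have S_ne: "S \<noteq> {}" unfolding S_def using M0 zero_less_one by blast
    have bdd: "bdd_above S"
      unfolding S_def using le[OF _ _ M0 zero_less_one] by (intro bdd_aboveI) blast
    define \<alpha> where "\<alpha> = Sup S"
    have lo: "(r - N (\<lambda>x. m x - s * v x)) / s \<le> \<alpha>" if "(m, r) \<in> M" "0 < s" for m r s
      unfolding \<alpha>_def using that by (intro cSup_upper[OF _ bdd]) (auto simp: S_def)
    have hi: "\<alpha> \<le> (N (\<lambda>x. m x + s * v x) - r) / s" if "(m, r) \<in> M" "0 < s" for m r s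
      unfolding \<alpha>_def using that le by (intro cSup_least[OF S_ne]) (auto simp: S_def)
    \<comment> \<open>The case that v already lies in the domain of \<open>M\<close> needs no
      separate treatment: maximality gives \<open>Y = M\<close> in either case.\<close>
    define Y where "Y = {((\<lambda>x. m x + s * v x), r + s * \<alpha>) | m r s. (m, r) \<in> M}"
    have YI: "(h, q) \<in> Y" if "(m, r) \<in> M" "h = (\<lambda>x. m x + s * v x)" "q = r + s * \<alpha>" for m r s h q
      unfolding Y_def using that by blast
    have "Y \<in> Z"
      unfolding Z_def
    proof (intro CollectI conjI allI impI)
      show "Y \<subseteq> X \<times> UNIV"
        unfolding Y_def using lin[OF MX v, of _ _ 1] by auto
      show "((\<lambda>x. 0), 0) \<in> Y"
        unfolding Y_def using M0 by force
    next
      fix f r h s a b assume "(f, r) \<in> Y" "(h, s) \<in> Y"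
      then obtain m1 r1 s1 m2 r2 s2 where *: "f = (\<lambda>x. m1 x + s1 * v x)" "r = r1 + s1 * \<alpha>" "(m1, r1) \<in> M"
        "h = (\<lambda>x. m2 x + s2 * v x)" "s = r2 + s2 * \<alpha>" "(m2, r2) \<in> M"
        unfolding Y_def by blast
      have "(\<lambda>x. a * f x + b * h x) = (\<lambda>x. (a * m1 x + b * m2 x) + (a * s1 + b * s2) * v x)"
        "a * r + b * s = (a * r1 + b * r2) + (a * s1 + b * s2) * \<alpha>"
        unfolding * by (auto simp: algebra_simps)
      then show "((\<lambda>x. a * f x + b * h x), a * r + b * s) \<in> Y"
        by (rule YI[OF Ml[OF *(3,6), of a b]])
    next
      fix f r assume "(f, r) \<in> Y"
      then obtain m r1 s where *: "f = (\<lambda>x. m x + s * v x)" "r = r1 + s * \<alpha>" "(m, r1) \<in> M"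
        unfolding Y_def by blast
      consider "s = 0" | "s > 0" | "s < 0" by linarith
      then show "r \<le> N f"
      proof cases
        case 1 then show ?thesis using MN[OF *(3)] * by simp
      next
        case 2 then show ?thesis using hi[OF *(3) 2] * by (simp add: field_simps)
      next
        case 3 then show ?thesis using lo[OF *(3), of "- s"] * by (simp add: field_simps)
      qed
    qed
    moreover have "M \<subseteq> Y"
    proof
      fix p assume "p \<in> M"
      then obtain m r where "p = (m, r)" "(m, r) \<in> M" by (cases p) auto
      then show "p \<in> Y" using YI[of m r _ 0] by simp
    qed
    ultimately have "Y = M" by (rule max)
    moreover have "(v, \<alpha>) \<in> Y" by (rule YI[OF M0, of _ 1]) simp_all
    ultimately show ?thesis by blast
  qed
  \<comment> \<open>A nonzero value over the zero function could be scaled beyond the fixed bound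
    \<open>N 0\<close>.\<close>
  have M00: "r = 0" if "((\<lambda>x. 0), r) \<in> M" for r
  proof (rule ccontr)
    assume "r \<noteq> 0"
    have "a * r \<le> N (\<lambda>x. 0)" for a
      using MN[OF Ml[OF that M0, of a 0]] by simp
    from this[of "(N (\<lambda>x. 0) + 1) / r"] \<open>r \<noteq> 0\<close> show False by simp
  qed
  have uniq: "r = s" if "(f, r) \<in> M" "(f, s) \<in> M" for f r s
    using M00[of "r - s"] Ml[OF that, of 1 "-1"] by simp
  define L where "L f = (THE r. (f, r) \<in> M)" for f
  have L: "(f, L f) \<in> M" if "f \<in> X" for f
    unfolding L_def using dom[OF that] uniq by (metis (mono_tags, lifting) theI)
  show thesis
  proof
    show "L (\<lambda>x. a * f x + b * g x) = a * L f + b * L g" if "f \<in> X" "g \<in> X" for f g a b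
      using uniq[OF L[OF lin[OF that]] Ml[OF L[OF that(1)] L[OF that(2)]]] .
    show "L f \<le> N f" if "f \<in> X" for f
      using MN[OF L[OF that]] .
  qed
qed

section \<open>Daniell integrals\<close>

text \<open>
  Kindler's construction: \<open>L\<close> induces a countably additive volume on the semiring of strips between
  two functions of \<open>H\<close>, since by Lebesgue measure of the sections a disjoint decomposition of a
  strip is a pointwise convergent series of heights; the measure of \<open>B\<close> is the volume of \<open>B \<times> [0,1)\<close>.
\<close>

definition strip :: "('a \<Rightarrow> real) \<times> ('a \<Rightarrow> real) \<Rightarrow> ('a \<times> real) set" where
  "strip p = {(x, t). fst p x \<le> t \<and> t < snd p x}"

text \<open>The k-th summand is the part of z lying between the heights k and k + 1.\<close>

lemma sum_clamp:
  fixes z :: real assumes "0 \<le> z"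
  shows "(\<Sum>k<n. max 0 (min 1 (z - real k))) = min z (real n)"
proof (induction n)
  case 0 then show ?case using assms by simp
next
  case (Suc n)
  then show ?case by (simp add: min_def max_def)
qed

lemma sum_indicator_ge_le:
  fixes z :: real assumes "0 \<le> z"
  shows "(\<Sum>k<n. if z > real k then 1 else 0) \<le> z + 1"
proof -
  have "(\<Sum>k<n. if z > real k then 1 else 0) \<le> min (z + 1) (real n)"
  proof (induction n)
    case 0 then show ?case using assms by simp
  next
    case (Suc n)
    then show ?case by (auto simp: min_def split: if_splits)
  qed
  then show ?thesis by simp
qed

text \<open>Members of \<open>H\<close> vanish off \<open>Om\<close>, so the indicator of
  \<open>Om\<close> stands in for the constant 1. \<open>opens\<close> is what makes the projection
  to the base Borel measurable, and \<open>L_cont\<close> is the Daniell condition behind countable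
  additivity.\<close>

locale daniell_functional =
  fixes H :: "('a::topological_space \<Rightarrow> real) set" and L :: "('a \<Rightarrow> real) \<Rightarrow> real" and Om :: "'a set"
  assumes lin: "\<And>f g a b. f \<in> H \<Longrightarrow> g \<in> H \<Longrightarrow> (\<lambda>x. a * f x + b * g x) \<in> H"
    and lattice: "\<And>f g. f \<in> H \<Longrightarrow> g \<in> H \<Longrightarrow> (\<lambda>x. max (f x) (g x)) \<in> H"
    and unit: "indicator Om \<in> H"
    and supp: "\<And>f x. f \<in> H \<Longrightarrow> x \<notin> Om \<Longrightarrow> f x = 0"
    and meas: "\<And>f. f \<in> H \<Longrightarrow> f \<in> borel_measurable borel"
    and opens: "\<And>G. open G \<Longrightarrow> \<exists>h\<in>H. (\<forall>x. 0 \<le> h x) \<and> {x. 0 < h x} = G \<inter> Om"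
    and L_lin: "\<And>f g a b. f \<in> H \<Longrightarrow> g \<in> H \<Longrightarrow> L (\<lambda>x. a * f x + b * g x) = a * L f + b * L g"
    and L_pos: "\<And>f. f \<in> H \<Longrightarrow> (\<And>x. 0 \<le> f x) \<Longrightarrow> 0 \<le> L f"
    and L_unit: "L (indicator Om) = 1"
    and L_cont: "\<And>g. (\<And>n. g n \<in> H) \<Longrightarrow> (\<And>n x. g (Suc n) x \<le> g n x) \<Longrightarrow>
      (\<And>x. (\<lambda>n. g n x) \<longlonglongrightarrow> 0) \<Longrightarrow> (\<lambda>n. L (g n)) \<longlonglongrightarrow> 0"
begin

lemma zero: "(\<lambda>x. 0) \<in> H"
  using lin[OF unit unit, of 0 0] by simp

lemma scale: "f \<in> H \<Longrightarrow> (\<lambda>x. a * f x) \<in> H"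
  using lin[of f f a 0] by simp

lemma diff: "f \<in> H \<Longrightarrow> g \<in> H \<Longrightarrow> (\<lambda>x. f x - g x) \<in> H"
  using lin[of f g 1 "-1"] by simp

lemma lattice_min: "f \<in> H \<Longrightarrow> g \<in> H \<Longrightarrow> (\<lambda>x. min (f x) (g x)) \<in> H"
proof -
  assume "f \<in> H" "g \<in> H"
  moreover have "(\<lambda>x. - 1 * max (- 1 * f x) (- 1 * g x)) = (\<lambda>x. min (f x) (g x))"
    by (auto simp: max_def min_def)
  ultimately show ?thesis
    using scale[OF lattice[OF scale[of f "-1"] scale[of g "-1"]], of "-1"] by simp
qed

lemma L_zero: "L (\<lambda>x. 0) = 0"
  using L_lin[OF unit unit, of 0 0] by simp

lemma L_scale: "f \<in> H \<Longrightarrow> L (\<lambda>x. a * f x) = a * L f"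
  using L_lin[of f f a 0] by simp

lemma L_diff: "f \<in> H \<Longrightarrow> g \<in> H \<Longrightarrow> L (\<lambda>x. f x - g x) = L f - L g"
  using L_lin[of f g 1 "-1"] by simp

lemma sum_closed:
  assumes "\<And>k::nat. f k \<in> H"
  shows "(\<lambda>x. \<Sum>k<n. f k x) \<in> H \<and> L (\<lambda>x. \<Sum>k<n. f k x) = (\<Sum>k<n. L (f k))"
proof (induction n)
  case 0 then show ?case by (simp add: zero L_zero)
next
  case (Suc n)
  then show ?case
    using lin[of "\<lambda>x. \<Sum>k<n. f k x" "f n" 1 1] L_lin[of "\<lambda>x. \<Sum>k<n. f k x" "f n" 1 1] assms by simp
qed

section \<open>The volume on the semiring of strips\<close>

definition strips :: "(('a \<Rightarrow> real) \<times> ('a \<Rightarrow> real)) set" where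
  "strips = {(f, g). f \<in> H \<and> g \<in> H \<and> (\<forall>x. f x \<le> g x)}"

definition strip_vol :: "('a \<Rightarrow> real) \<times> ('a \<Rightarrow> real) \<Rightarrow> ennreal" where
  "strip_vol p = ennreal (L (\<lambda>x. snd p x - fst p x))"

definition strip_measure :: "('a \<times> real) measure" where
  "strip_measure = extend_measure UNIV strips strip strip_vol"

lemma strip_section:
  assumes "p \<in> strips"
  shows "Pair x -` strip p \<in> sets lborel"
    and "emeasure lborel (Pair x -` strip p) = ennreal (snd p x - fst p x)"
proof -
  have eq: "Pair x -` strip p = {fst p x..<snd p x}"
    by (auto simp: strip_def)
  show "Pair x -` strip p \<in> sets lborel"
    "emeasure lborel (Pair x -` strip p) = ennreal (snd p x - fst p x)"
    unfolding eq using assms by (auto simp: strips_def)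
qed

text \<open>Sections are half-open intervals, so removing one strip from another leaves at most a
  lower piece ending at \<open>f2\<close> and an upper piece starting at \<open>g2\<close>.\<close>

lemma semiring_strips: "semiring_of_sets UNIV (strip ` strips)"
proof
  show "strip ` strips \<subseteq> Pow UNIV" by simp
  show "{} \<in> strip ` strips"
    by (rule image_eqI[of _ _ "((\<lambda>x. 0), (\<lambda>x. 0))"]) (auto simp: strip_def strips_def zero)
next
  fix s t assume "s \<in> strip ` strips" "t \<in> strip ` strips"
  then obtain f1 g1 f2 g2 where 1: "s = strip (f1, g1)" "f1 \<in> H" "g1 \<in> H" "\<And>x. f1 x \<le> g1 x"
    and 2: "t = strip (f2, g2)" "f2 \<in> H" "g2 \<in> H" "\<And>x. f2 x \<le> g2 x"
    by (auto simp: strips_def)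
  note closed = 1 2 lattice lattice_min
  \<comment> \<open>The outer \<open>max\<close> closes the strip over points where the two sections
    do not meet; there min(g1, g2) may lie below the lower boundary. The clamps in \<open>?a\<close>
    and \<open>?b\<close> do the same job.\<close>
  show "s \<inter> t \<in> strip ` strips"
    by (rule image_eqI[of _ _ "((\<lambda>x. max (f1 x) (f2 x)),
        (\<lambda>x. max (max (f1 x) (f2 x)) (min (g1 x) (g2 x))))"])
      (use closed in \<open>auto simp: strip_def strips_def\<close>)
  let ?a = "strip (f1, (\<lambda>x. max (f1 x) (min (g1 x) (f2 x))))"
  let ?b = "strip ((\<lambda>x. min (g1 x) (max (f1 x) (g2 x))), g1)"
  have "?a \<in> strip ` strips" "?b \<in> strip ` strips"
    by (intro imageI, use closed in \<open>auto simp: strips_def\<close>)+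
  moreover have "?a \<inter> ?b = {}"
  proof -
    have False if "(x, r) \<in> ?a" "(x, r) \<in> ?b" for x r
      using that 2(4)[of x] 1(4)[of x] by (auto simp: strip_def min_def max_def split: if_splits)
    then show ?thesis by auto
  qed
  moreover have "s - t = ?a \<union> ?b"
  proof -
    have "(x, r) \<in> s - t \<longleftrightarrow> (x, r) \<in> ?a \<union> ?b" for x r
      using 2(4)[of x] 1(4)[of x] by (auto simp: 1(1) 2(1) strip_def min_def max_def split: if_splits)
    then show ?thesis by auto
  qed
  ultimately show "\<exists>C\<subseteq>strip ` strips. finite C \<and> disjoint C \<and> s - t = \<Union>C"
    by (intro exI[of _ "{?a, ?b}"]) (auto simp: disjoint_def)
qed

lemma emeasure_strip:
  assumes "i \<in> strips"
  shows "emeasure strip_measure (strip i) = strip_vol i"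
proof (rule extend_measure_caratheodory[OF strip_measure_def assms semiring_strips])
  \<comment> \<open>The volume is defined on index pairs; section lengths recover the height, so it
    depends only on the strip.\<close>
  have eq: "strip_vol i = strip_vol j" if "i \<in> strips" "j \<in> strips" "strip i = strip j" for i j
  proof -
    have "snd i x - fst i x = snd j x - fst j x" for x
    proof -
      have "ennreal (snd i x - fst i x) = ennreal (snd j x - fst j x)"
        using strip_section(2)[of i x] strip_section(2)[of j x] that by simp
      then show ?thesis
        using that by (subst (asm) ennreal_inj) (auto simp: strips_def)
    qed
    then show ?thesis by (simp add: strip_vol_def)
  qed
  show "strip_vol i = 0" if "i \<in> strips" "strip i = {}" for i
  proof -
    have "strip_vol i = strip_vol ((\<lambda>x. 0), (\<lambda>x. 0))"
      by (rule eq) (use that in \<open>auto simp: strips_def strip_def zero\<close>)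
    then show ?thesis by (simp add: strip_vol_def L_zero)
  qed
  show "strip_vol i = strip_vol j" if "i \<in> strips" "j \<in> strips" "strip i = strip j" for i j
    using that by (rule eq)
  show "0 \<le> strip_vol i" for i by simp
  fix A :: "nat \<Rightarrow> _" and j
  assume A: "A \<in> UNIV \<rightarrow> strips" and j: "j \<in> strips" and disj: "disjoint_family (strip \<circ> A)"
    and un: "(\<Union>i. strip (A i)) = strip j"
  have An: "A n \<in> strips" for n using A by auto
  define w where "w n = (\<lambda>x. snd (A n) x - fst (A n) x)" for n
  define v where "v = (\<lambda>x. snd j x - fst j x)"
  have w: "w n \<in> H" "0 \<le> w n x" for n x
    using An[of n] diff by (auto simp: strips_def w_def)
  have v: "v \<in> H" "0 \<le> v x" for x
    using j diff by (auto simp: strips_def v_def)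
  have w_sums: "(\<lambda>n. w n x) sums v x" for x
  proof -
    have "(\<Sum>n. emeasure lborel (Pair x -` strip (A n))) = emeasure lborel (\<Union>n. Pair x -` strip (A n))"
      using strip_section(1)[OF An] disj
      by (intro suminf_emeasure) (fastforce simp: disjoint_family_on_def)+
    also have "(\<Union>n. Pair x -` strip (A n)) = Pair x -` strip j"
      unfolding un[symmetric] by (rule vimage_UN[symmetric])
    finally have "(\<Sum>n. ennreal (w n x)) = ennreal (v x)"
      using strip_section(2)[OF An] strip_section(2)[OF j] by (simp add: w_def v_def)
    moreover have "(\<lambda>n. ennreal (w n x)) sums (\<Sum>n. ennreal (w n x))" by (simp add: summable_sums)
    ultimately show ?thesis using w v by (simp add: sums_ennreal)
  qed
  \<comment> \<open>The remainders decrease pointwise to 0, so \<open>L_cont\<close> turns the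
    pointwise series into convergence of the series of volumes.\<close>
  define r where "r n = (\<lambda>x. v x - (\<Sum>k<n. w k x))" for n
  have "(\<lambda>n. L (r n)) \<longlonglongrightarrow> 0"
  proof (rule L_cont)
    show "r n \<in> H" for n unfolding r_def by (intro diff v conjunct1[OF sum_closed] w)
    show "r (Suc n) x \<le> r n x" for n x using w by (simp add: r_def)
    show "(\<lambda>n. r n x) \<longlonglongrightarrow> 0" for x
      using tendsto_diff[OF tendsto_const[of "v x"] w_sums[of x, unfolded sums_def]] by (simp add: r_def)
  qed
  moreover have "L (r n) = L v - (\<Sum>k<n. L (w k))" for n
    unfolding r_def using sum_closed[of w n] w v by (subst L_diff) auto
  ultimately have "(\<lambda>n. L v - (L v - (\<Sum>k<n. L (w k)))) \<longlonglongrightarrow> L v - 0"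
    by (intro tendsto_diff) auto
  then have "(\<lambda>n. L (w n)) sums L v" by (simp add: sums_def)
  then have "(\<Sum>n. ennreal (L (w n))) = ennreal (L v)"
    using L_pos[OF w] by (intro suminf_ennreal_eq) auto
  then show "(\<Sum>n. strip_vol (A n)) = strip_vol j"
    by (simp add: strip_vol_def w_def v_def)
qed

section \<open>The representing measure\<close>

lemma strip_sets: "i \<in> strips \<Longrightarrow> strip i \<in> sets strip_measure"
  unfolding strip_measure_def by (subst sets_extend_measure) auto

text \<open>This is \<open>Om\<close> x [0,1): off \<open>Om\<close> the section [0,0) is empty, so
  \<open>rep\<close> puts no mass there.\<close>

definition base :: "('a \<times> real) set" where "base = strip ((\<lambda>x. 0), indicator Om)"

lemma base_strip: "((\<lambda>x. 0), indicator Om) \<in> strips"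
  by (auto simp: strips_def zero unit)

lemma base_sets: "base \<in> sets strip_measure"
  unfolding base_def by (rule strip_sets[OF base_strip])

definition rep :: "'a measure" where
  "rep = distr (restrict_space strip_measure base) borel fst"

lemma sets_rep [simp]: "sets rep = sets borel" by (simp add: rep_def)

lemma space_rep [simp]: "space rep = UNIV" by (simp add: rep_def)

text \<open>Preimages of open sets suffice. If h is positive exactly on the part of G inside
  \<open>Om\<close>, then the base over G is the increasing union of the strips under min(1, n
  h).\<close>

lemma fst_measurable: "fst \<in> restrict_space strip_measure base \<rightarrow>\<^sub>M borel"
proof (rule borel_measurableI)
  fix G :: "'a set" assume "open G"
  then obtain h where h: "h \<in> H" "\<And>x. 0 \<le> h x" "{x. 0 < h x} = G \<inter> Om"
    using opens by blast
  define p where "p n = ((\<lambda>x::'a. 0::real), (\<lambda>x. min (indicator Om x) (real n * h x)))" for n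
  have p: "p n \<in> strips" for n
    by (auto simp: p_def strips_def zero h intro!: lattice_min unit scale)
  have "(x, t) \<in> fst -` G \<inter> base \<longleftrightarrow> (x, t) \<in> (\<Union>n. strip (p n))" for x t
  proof
    assume *: "(x, t) \<in> fst -` G \<inter> base"
    then have x: "x \<in> G" "x \<in> Om" "0 \<le> t" "t < 1"
      by (auto simp: base_def strip_def indicator_def of_bool_def split: if_splits)
    then have "0 < h x" using h(3) by blast
    then obtain n where "t / h x < real n" using reals_Archimedean2 by blast
    then show "(x, t) \<in> (\<Union>n. strip (p n))"
      using x \<open>0 < h x\<close> by (auto simp: p_def strip_def field_simps)
  next
    assume "(x, t) \<in> (\<Union>n. strip (p n))"
    then obtain n where *: "0 \<le> t" "t < indicator Om x" "t < real n * h x"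
      by (auto simp: p_def strip_def)
    then have "0 < h x" using h(2)[of x] by (cases "h x = 0") (auto simp: less_le)
    then have "x \<in> G" using h(3) by blast
    then show "(x, t) \<in> fst -` G \<inter> base" using * by (auto simp: base_def strip_def)
  qed
  then have "fst -` G \<inter> base = (\<Union>n. strip (p n))" by (intro set_eqI) (simp only: split_paired_all)
  also have "\<dots> \<in> sets strip_measure" using strip_sets[OF p] by auto
  finally have "fst -` G \<inter> base \<in> sets (restrict_space strip_measure base)"
    using base_sets by (auto simp: sets_restrict_space)
  moreover have "space (restrict_space strip_measure base) = base"
    using sets.sets_into_space[OF base_sets] by (auto simp: space_restrict_space)
  ultimately show "fst -` G \<inter> space (restrict_space strip_measure base) \<in> sets (restrict_space strip_measure base)"
    by simp
qed

lemma emeasure_rep: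
  assumes "B \<in> sets borel"
  shows "emeasure rep B = emeasure strip_measure (fst -` B \<inter> base)"
    and "fst -` B \<inter> base \<in> sets strip_measure"
proof -
  have sp: "space (restrict_space strip_measure base) = base"
    using sets.sets_into_space[OF base_sets] by (auto simp: space_restrict_space)
  have m: "fst -` B \<inter> base \<in> sets (restrict_space strip_measure base)"
    using measurable_sets[OF fst_measurable assms] by (simp add: sp)
  then show "fst -` B \<inter> base \<in> sets strip_measure"
    using base_sets by (simp add: sets_restrict_space_iff)
  show "emeasure rep B = emeasure strip_measure (fst -` B \<inter> base)"
    unfolding rep_def using assms base_sets m
    by (subst emeasure_distr[OF fst_measurable]) (auto simp: sp emeasure_restrict_space)
qed

lemma emeasure_rep_UNIV: "emeasure rep UNIV = 1"
  using emeasure_rep(1)[of UNIV] emeasure_strip[OF base_strip]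
  by (simp add: base_def strip_vol_def L_unit)

lemma prob_space_rep: "prob_space rep"
  by (rule prob_spaceI) (simp add: emeasure_rep_UNIV)

lemma Om_borel: "Om \<in> sets borel"
proof -
  have "Om = (indicator Om :: 'a \<Rightarrow> real) -` {1} \<inter> space borel" by (auto simp: indicator_def split: if_splits)
  also have "\<dots> \<in> sets borel" by (rule measurable_sets[OF meas[OF unit]]) simp
  finally show ?thesis .
qed

lemma emeasure_rep_Om: "emeasure rep Om = 1"
proof -
  have "fst -` Om \<inter> base = base" by (auto simp: base_def strip_def indicator_def of_bool_def split: if_splits)
  then show ?thesis
    using emeasure_rep(1)[OF Om_borel] emeasure_rep(1)[of UNIV] emeasure_rep_UNIV by simp
qed

section \<open>The functional is integration against the measure\<close>

lemma L_mono: "f \<in> H \<Longrightarrow> g \<in> H \<Longrightarrow> (\<And>x. f x \<le> g x) \<Longrightarrow> L f \<le> L g"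
  using L_pos[OF diff[of g f]] L_diff[of g f] by simp

text \<open>Layer-cake comparison: the slices \<open>max 0 (min 1 (n f - k))\<close> of \<open>n f\<close> sum to \<open>n f\<close>, and the
  functional of a slice is at most the measure of \<open>{n f > k}\<close>.\<close>

lemma L_le_integral:
  assumes f: "f \<in> H" "\<And>x. 0 \<le> f x" "\<And>x. f x \<le> 1"
  shows "L f \<le> integral\<^sup>L rep f"
proof -
  interpret prob_space rep by (rule prob_space_rep)
  have [measurable]: "f \<in> borel_measurable borel" by (rule meas[OF f(1)])
  have [measurable]: "f \<in> borel_measurable rep" by (simp add: measurable_cong_sets[OF sets_rep])
  have int: "integrable rep f"
    by (rule integrable_const_bound[of _ 1]) (use f in auto)
  have "L f \<le> integral\<^sup>L rep f + 1 / real n" if "n > 0" for n :: nat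
  proof -
    \<comment> \<open>The constants 1 and k are multiplied by the indicator of \<open>Om\<close> to
      keep the slice in \<open>H\<close>.\<close>
    define c where "c k = (\<lambda>x. max 0 (min (indicator Om x) (real n * f x - real k * indicator Om x)))" for k :: nat
    have c: "c k \<in> H" for k
      unfolding c_def by (intro lattice zero lattice_min unit diff scale f)
    have nf: "(\<Sum>k<n. c k x) = real n * f x" for x
    proof (cases "x \<in> Om")
      case True
      then have "(\<Sum>k<n. c k x) = (\<Sum>k<n. max 0 (min 1 (real n * f x - real k)))"
        by (simp add: c_def)
      also have "\<dots> = min (real n * f x) (real n)"
        using f by (intro sum_clamp) simp
      also have "\<dots> = real n * f x"
        using f(3)[of x] by (simp add: mult_left_le min_absorb1)
      finally show ?thesis .
    next
      case False then show ?thesis using supp[OF f(1)] by (simp add: c_def)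
    qed
    \<comment> \<open>A slice is at most 1 and is positive only where n f > k, so the strip below it
      lies in {n f > k} x [0,1).\<close>
    have Lc: "L (c k) \<le> measure rep {x. real n * f x > real k}" for k
    proof -
      have s: "((\<lambda>x. 0), c k) \<in> strips" by (auto simp: strips_def zero c) (simp add: c_def)
      have B: "{x. real n * f x > real k} \<in> sets borel" by measurable
      have "ennreal (L (c k)) = emeasure strip_measure (strip ((\<lambda>x. 0), c k))"
        using emeasure_strip[OF s] by (simp add: strip_vol_def)
      also have "\<dots> \<le> emeasure strip_measure (fst -` {x. real n * f x > real k} \<inter> base)"
        using emeasure_rep(2)[OF B]
        by (intro emeasure_mono) (auto simp: strip_def base_def c_def indicator_def of_bool_def less_max_iff_disj split: if_splits)
      also have "\<dots> = ennreal (measure rep {x. real n * f x > real k})"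
        using emeasure_rep(1)[OF B] by (simp add: emeasure_eq_measure)
      finally show ?thesis by simp
    qed
    have "real n * L f = (\<Sum>k<n. L (c k))"
      using conjunct2[OF sum_closed[of c n, OF c]] L_scale[OF f(1), of "real n"] by (simp add: nf)
    also have "\<dots> \<le> (\<Sum>k<n. measure rep {x. real n * f x > real k})"
      by (intro sum_mono Lc)
    also have "\<dots> = (\<Sum>k<n. integral\<^sup>L rep (indicator {x. real n * f x > real k}))"
      by simp
    also have "\<dots> = integral\<^sup>L rep (\<lambda>x. \<Sum>k<n. indicator {x. real n * f x > real k} x)"
      by (intro Bochner_Integration.integral_sum[symmetric]) (auto simp: emeasure_eq_measure)
    \<comment> \<open>Counting the levels k below n f overshoots n f by at most 1; after division by
      n this error vanishes in the limit.\<close>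
    also have "\<dots> \<le> integral\<^sup>L rep (\<lambda>x. real n * f x + 1)"
    proof (intro integral_mono)
      fix x
      show "(\<Sum>k<n. indicator {x. real n * f x > real k} x) \<le> real n * f x + 1"
        using sum_indicator_ge_le[of "real n * f x" n] f(2)[of x] by (simp add: indicator_def of_bool_def)
    qed (use int in \<open>auto simp: emeasure_eq_measure\<close>)
    also have "\<dots> = real n * integral\<^sup>L rep f + 1"
      using int prob_space by simp
    finally show ?thesis using that by (simp add: field_simps)
  qed
  then have "\<forall>\<^sub>F n in sequentially. L f \<le> integral\<^sup>L rep f + 1 / real n"
    by (intro eventually_sequentiallyI[of 1]) auto
  moreover have "(\<lambda>n. integral\<^sup>L rep f + 1 / real n) \<longlonglongrightarrow> integral\<^sup>L rep f + 0"
    by (intro tendsto_intros lim_1_over_n)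
  ultimately show ?thesis
    using tendsto_lowerbound[of _ "integral\<^sup>L rep f" sequentially "L f"] by simp
qed

text \<open>The reverse inequality is the one-sided comparison applied to 1 - f on
  \<open>Om\<close>, because L and the integral both give the unit the value 1.\<close>

lemma L_eq_integral_unit:
  assumes f: "f \<in> H" "\<And>x. 0 \<le> f x" "\<And>x. f x \<le> 1"
  shows "integrable rep f" "L f = integral\<^sup>L rep f"
proof -
  interpret prob_space rep by (rule prob_space_rep)
  have [measurable]: "f \<in> borel_measurable borel" by (rule meas[OF f(1)])
  have [measurable]: "f \<in> borel_measurable rep" by (simp add: measurable_cong_sets[OF sets_rep])
  show int: "integrable rep f"
    by (rule integrable_const_bound[of _ 1]) (use f in auto)
  have Om: "integral\<^sup>L rep (indicat_real Om) = 1"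
    using emeasure_rep_Om by (simp add: measure_def)
  have "L (\<lambda>x. indicator Om x - f x) \<le> integral\<^sup>L rep (\<lambda>x. indicator Om x - f x)"
    using f supp[OF f(1)] by (intro L_le_integral diff unit) (auto simp: indicator_def)
  also have "\<dots> = 1 - integral\<^sup>L rep f"
    using int Om Om_borel by (subst Bochner_Integration.integral_diff) (auto simp: emeasure_eq_measure)
  finally have "integral\<^sup>L rep f \<le> L f"
    using L_diff[OF unit f(1)] L_unit by simp
  with L_le_integral[OF f] show "L f = integral\<^sup>L rep f" by simp
qed

text \<open>Truncations at height n + 1 become functions with values in [0,1] after rescaling. The
  gap f - g n decreases to 0, so \<open>L_cont\<close> on one side and monotone convergence on the
  other give the same limit.\<close>

lemma L_eq_integral_nonneg:
  assumes f: "f \<in> H" "\<And>x. 0 \<le> f x"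
  shows "integrable rep f \<and> L f = integral\<^sup>L rep f"
proof -
  define g where "g n = (\<lambda>x. min (f x) (real (Suc n) * indicator Om x))" for n
  have g: "g n \<in> H" for n unfolding g_def by (intro lattice_min f scale unit)
  have gi: "integrable rep (g n)" "L (g n) = integral\<^sup>L rep (g n)" for n
  proof -
    let ?h = "\<lambda>x. 1 / real (Suc n) * g n x"
    have h: "?h \<in> H" "\<And>x. 0 \<le> ?h x" "\<And>x. ?h x \<le> 1"
      by (rule scale[OF g]) (use f in \<open>auto simp: g_def indicator_def field_simps min_def\<close>)
    have "integrable rep (\<lambda>x. real (Suc n) * ?h x)"
      using L_eq_integral_unit(1)[OF h] by (rule integrable_mult_right)
    then show "integrable rep (g n)" by (simp del: of_nat_Suc)
    show "L (g n) = integral\<^sup>L rep (g n)"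
      using L_eq_integral_unit(2)[OF h] L_scale[OF g, of "1 / real (Suc n)"] by simp
  qed
  have lim: "(\<lambda>n. g n x) \<longlonglongrightarrow> f x" for x
  proof (rule tendsto_eventually)
    obtain N where "f x \<le> real N" using real_arch_simple by blast
    then show "\<forall>\<^sub>F n in sequentially. g n x = f x"
      using supp[OF f(1)] f(2)[of x]
      by (intro eventually_sequentiallyI[of N]) (auto simp: g_def indicator_def min_def)
  qed
  have mono: "mono (\<lambda>n. g n x)" for x
    by (rule incseq_SucI) (auto simp: g_def indicator_def min_def)
  have "(\<lambda>n. L (\<lambda>x. f x - g n x)) \<longlonglongrightarrow> 0"
  proof (rule L_cont)
    show "(\<lambda>x. f x - g n x) \<in> H" for n by (intro diff f g)
    show "f x - g (Suc n) x \<le> f x - g n x" for n x using monoD[OF mono, of n "Suc n"] by simp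
    show "(\<lambda>n. f x - g n x) \<longlonglongrightarrow> 0" for x
      using tendsto_diff[OF tendsto_const lim[of x], of "f x"] by simp
  qed
  then have "(\<lambda>n. L f - (L f - L (g n))) \<longlonglongrightarrow> L f - 0"
    using L_diff[OF f(1) g] by (intro tendsto_diff) auto
  then have "(\<lambda>n. integral\<^sup>L rep (g n)) \<longlonglongrightarrow> L f" by (simp add: gi)
  with gi(1) mono lim show ?thesis
    using integrable_monotone_convergence[of rep g f "L f"] integral_monotone_convergence[of rep g f "L f"]
      meas[OF f(1)] by (auto simp: rep_def)
qed

theorem representation:
  assumes f: "f \<in> H"
  shows "integrable rep f" "integral\<^sup>L rep f = L f"
proof -
  have H: "(\<lambda>x. max (f x) 0) \<in> H" "(\<lambda>x. max (- f x) 0) \<in> H"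
    using lattice[OF f zero] lattice[OF scale[OF f, of "-1"] zero] by auto
  have eq: "(\<lambda>x. max (f x) 0 - max (- f x) 0) = f" by (auto simp: max_def)
  note P = L_eq_integral_nonneg[OF H(1)] L_eq_integral_nonneg[OF H(2)]
  show "integrable rep f"
    using Bochner_Integration.integrable_diff[of rep "\<lambda>x. max (f x) 0" "\<lambda>x. max (- f x) 0"] P eq by simp
  show "integral\<^sup>L rep f = L f"
    using Bochner_Integration.integral_diff[of rep "\<lambda>x. max (f x) 0" "\<lambda>x. max (- f x) 0"] P
      L_diff[OF H] by (simp add: eq)
qed

end

section \<open>Functions of linear growth\<close>

lemma Dini_to_zero:
  fixes g :: "nat \<Rightarrow> 'a::topological_space \<Rightarrow> real"
  assumes S: "compact S" and cont: "\<And>n. continuous_on S (g n)"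
    and decr: "\<And>n x. x \<in> S \<Longrightarrow> g (Suc n) x \<le> g n x"
    and lim: "\<And>x. x \<in> S \<Longrightarrow> (\<lambda>n. g n x) \<longlonglongrightarrow> 0" and e: "0 < e"
  obtains N where "\<And>n x. N \<le> n \<Longrightarrow> x \<in> S \<Longrightarrow> g n x < e"
proof -
  have "\<exists>V. open V \<and> V \<inter> S = g n -` {..<e} \<inter> S" for n
    using cont[of n] by (auto simp: continuous_on_open_invariant)
  then obtain V where V: "\<And>n. open (V n)" "\<And>n. V n \<inter> S = g n -` {..<e} \<inter> S" by metis
  have "S \<subseteq> (\<Union>n. V n)"
  proof
    fix x assume "x \<in> S"
    from order_tendstoD(2)[OF lim[OF this] e] obtain n where "g n x < e"
      by (auto simp: eventually_sequentially)
    with \<open>x \<in> S\<close> V(2)[of n] show "x \<in> (\<Union>n. V n)" by blast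
  qed
  then obtain C where C: "finite C" "S \<subseteq> (\<Union>n\<in>C. V n)"
    using compactE_image[OF S, of UNIV V] V(1) by auto
  have le: "g n x \<le> g m x" if "m \<le> n" "x \<in> S" for m n x
    using that(1) by (induction n rule: dec_induct) (auto intro: order_trans[OF decr[OF that(2)]])
  \<comment> \<open>The subcover consists of sets that grow with the index, so its largest index
    works; inserting 0 keeps the maximum defined when the subcover is empty.\<close>
  show thesis
  proof (rule that[of "Max (insert 0 C)"])
    fix n x assume n: "Max (insert 0 C) \<le> n" and x: "x \<in> S"
    then obtain m where m: "m \<in> C" "x \<in> V m" using C by blast
    then have "m \<le> n" using n C(1) by (meson Max_ge finite_insert insertCI order_trans)
    moreover have "g m x < e" using V(2)[of m] m x by blast
    ultimately show "g n x < e" using le[of m n x] x by simp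
  qed
qed

text \<open>The infimal convolution of min(u, n) with n times the distance. Truncation keeps it real
  where u is infinite, and taking the infimum over S alone still gives an n-Lipschitz function on
  the whole space.\<close>

lemma lsc_Lipschitz_approximation:
  fixes u :: "'a::metric_space \<Rightarrow> ereal"
  assumes ne: "S \<noteq> {}" and nn: "\<And>x. x \<in> S \<Longrightarrow> 0 \<le> u x"
    and lsc: "\<And>x y. x \<in> S \<Longrightarrow> y < u x \<Longrightarrow> \<forall>\<^sub>F x' in at x within S. y < u x'"
  obtains v :: "nat \<Rightarrow> 'a \<Rightarrow> real" where
    "\<And>n. continuous_on UNIV (v n)" "\<And>n x. 0 \<le> v n x"
    "\<And>n x. x \<in> S \<Longrightarrow> v n x \<le> real n"
    "\<And>n x. v n x \<le> v (Suc n) x" "\<And>x. x \<in> S \<Longrightarrow> (SUP n. ereal (v n x)) = u x"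
proof -
  define m where "m n y = real_of_ereal (min (u y) (ereal (real n)))" for n y
  define v where "v n x = (INF y\<in>S. m n y + real n * dist x y)" for n x
  have m: "ereal (m n y) = min (u y) (ereal (real n))" if "y \<in> S" for n y
    unfolding m_def using nn[OF that] by (cases "u y") (auto simp: min_def)
  have m0: "0 \<le> m n y" if "y \<in> S" for n y
    unfolding m_def using nn[OF that] by (intro real_of_ereal_pos) simp
  have bdd: "bdd_below ((\<lambda>y. m n y + real n * dist x y) ` S)" for n x
    using m0 by (intro bdd_belowI[of _ 0]) auto
  have v_le: "v n x \<le> m n y + real n * dist x y" if "y \<in> S" for n x y
    unfolding v_def using bdd that by (rule cINF_lower)
  have v_ge: "b \<le> v n x" if "\<And>y. y \<in> S \<Longrightarrow> b \<le> m n y + real n * dist x y" for n x b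
    unfolding v_def using ne that by (rule cINF_greatest)
  have Lip: "v n x \<le> v n x' + real n * dist x x'" for n x x'
  proof -
    have "v n x - real n * dist x x' \<le> v n x'"
    proof (rule v_ge)
      fix y assume "y \<in> S"
      have "v n x \<le> m n y + real n * dist x y" by (rule v_le[OF \<open>y \<in> S\<close>])
      also have "\<dots> \<le> m n y + real n * (dist x x' + dist x' y)"
        by (intro add_left_mono mult_left_mono dist_triangle) simp
      finally show "v n x - real n * dist x x' \<le> m n y + real n * dist x' y"
        by (simp add: algebra_simps)
    qed
    then show ?thesis by simp
  qed
  show thesis
  proof
    fix n
    have "(real n)-lipschitz_on UNIV (v n)"
    proof (rule lipschitz_onI)
      fix x y
      show "dist (v n x) (v n y) \<le> real n * dist x y"
        using Lip[of n x y] Lip[of n y x] by (auto simp: dist_real_def dist_commute)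
    qed simp
    then show "continuous_on UNIV (v n)" by (rule lipschitz_on_continuous_on)
    show "0 \<le> v n x" for x using m0 by (intro v_ge) simp
    show "v n x \<le> real n" if "x \<in> S" for x
    proof -
      have "ereal (m n x) \<le> ereal (real n)" using m[OF that] by simp
      then show ?thesis using v_le[OF that, of n x] by simp
    qed
    show "v n x \<le> v (Suc n) x" for x
    proof (rule v_ge)
      fix y assume y: "y \<in> S"
      have "ereal (m n y) \<le> ereal (m (Suc n) y)" unfolding m[OF y] by (intro min.mono) auto
      then have "m n y \<le> m (Suc n) y" by simp
      moreover have "real (Suc n) * dist x y = dist x y + real n * dist x y" by (simp add: algebra_simps)
      ultimately show "v n x \<le> m (Suc n) y + real (Suc n) * dist x y"
        using v_le[OF y, of n x] zero_le_dist[of x y] by linarith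
    qed
  next
    fix x assume x: "x \<in> S"
    show "(SUP n. ereal (v n x)) = u x"
    proof (rule antisym)
      show "(SUP n. ereal (v n x)) \<le> u x"
      proof (rule SUP_least)
        fix n
        have "ereal (v n x) \<le> ereal (m n x)" using v_le[OF x, of n x] by simp
        also have "\<dots> \<le> u x" using m[OF x] by simp
        finally show "ereal (v n x) \<le> u x" .
      qed
      show "u x \<le> (SUP n. ereal (v n x))"
      proof (rule ccontr)
        assume "\<not> u x \<le> (SUP n. ereal (v n x))"
        then obtain r where r: "(SUP n. ereal (v n x)) < ereal r" "ereal r < u x"
          using ereal_dense2 by (auto simp: not_le)
        have "ereal 0 \<le> (SUP n. ereal (v n x))"
          by (rule SUP_upper2[of 0]) (use m0 in \<open>auto intro!: v_ge\<close>)
        with r have r0: "0 \<le> r" by (metis ereal_less_eq(3) less_imp_le order_trans)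
        obtain \<delta> where \<delta>: "0 < \<delta>" "\<And>y. y \<in> S \<Longrightarrow> y \<noteq> x \<Longrightarrow> dist y x < \<delta> \<Longrightarrow> ereal r < u y"
          using lsc[OF x r(2)] by (auto simp: eventually_at)
        \<comment> \<open>Within \<delta> of x semicontinuity keeps u above r, which needs n >= r
          because of the truncation; farther away the distance term alone reaches n \<delta> >=
          r.\<close>
        obtain n where n: "max r (r / \<delta>) \<le> real n" using real_arch_simple by blast
        have "r \<le> v n x"
        proof (rule v_ge)
          fix y assume y: "y \<in> S"
          show "r \<le> m n y + real n * dist x y"
          proof (cases "dist y x < \<delta>")
            case True
            then have "ereal r < u y" using \<delta>(2)[OF y] r(2) by (cases "y = x") auto
            then have "ereal r \<le> ereal (m n y)" unfolding m[OF y] using n by simp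
            then show ?thesis by (simp add: add_increasing2)
          next
            case False
            have "r \<le> real n * \<delta>" using n \<delta>(1) by (simp add: field_simps)
            also have "\<dots> \<le> real n * dist x y" using False by (intro mult_left_mono) (auto simp: dist_commute)
            finally show ?thesis using m0[OF y, of n] by simp
          qed
        qed
        then have "ereal r \<le> (SUP n. ereal (v n x))" by (intro SUP_upper2[of n]) auto
        with r(1) show False by simp
      qed
    qed
  qed
qed

section \<open>Omega and the spaces of functions of linear growth\<close>

lemma continuous_on_absum: "continuous_on S (absum d t)"
  unfolding absum_def by (intro continuous_intros continuous_on_product_coordinates[THEN continuous_on_subset]) auto

lemma absum_nonneg: "0 \<le> absum d t x"
  unfolding absum_def by (intro sum_nonneg) auto

lemma absum_mono: "s \<le> t \<Longrightarrow> absum d s x \<le> absum d t x"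
  unfolding absum_def by (intro sum_mono2) (auto intro: sum_nonneg)

lemma coord_le_absum:
  assumes "t \<le> T" "j \<in> {1..d}" shows "\<bar>x (t, j)\<bar> \<le> absum d T x"
proof -
  have "\<bar>x (t, j)\<bar> \<le> (\<Sum>j=1..d. \<bar>x (t, j)\<bar>)"
    using assms by (intro member_le_sum) auto
  also have "\<dots> \<le> absum d T x"
    unfolding absum_def using assms by (intro member_le_sum[of t "{..T}" "\<lambda>s. \<Sum>j=1..d. \<bar>x (s, j)\<bar>"]) (auto intro: sum_nonneg)
  finally show ?thesis .
qed

lemma closed_Omega:
  assumes "\<forall>t\<le>T. \<forall>j\<in>{1..d}. closed (K t j)"
  shows "closed (Omega d T K)"
proof -
  have c: "closed ((\<lambda>x :: pt. x i) -` C)" if "closed C" for i C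
    by (rule closed_vimage[OF that]) (rule continuous_on_product_coordinates)
  have "Omega d T K = (\<Inter>t\<in>{..T}. \<Inter>j\<in>{1..d}. (\<lambda>x. x (t, j)) -` K t j) \<inter>
      (\<Inter>i\<in>{(t, j). T < t \<or> j \<notin> {1..d}}. (\<lambda>x. x i) -` {0})"
    by (auto simp: Omega_def)
  also have "closed \<dots>"
    using assms by (intro closed_Int closed_INT ballI c) auto
  finally show ?thesis .
qed

text \<open>The point type has infinitely many coordinates, so compactness comes from Tychonoff:
  every coordinate, including those fixed at 0, lies in [-|R|, |R|]. The absolute value of R covers
  negative R.\<close>

lemma compact_Omega_absum_le:
  assumes "\<forall>t\<le>T. \<forall>j\<in>{1..d}. closed (K t j)"
  shows "compact {x \<in> Omega d T K. absum d T x \<le> R}"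
proof -
  define B where "B = PiE UNIV (\<lambda>i :: nat \<times> nat. {- \<bar>R\<bar>..\<bar>R\<bar>})"
  have "compactin (product_topology (\<lambda>i. euclidean) UNIV) B"
    unfolding B_def by (subst compactin_PiE) auto
  then have "compact B" by (simp add: euclidean_product_topology)
  moreover have "closed {x \<in> Omega d T K. absum d T x \<le> R}"
    by (rule closed_Collect_conj) (auto simp: closed_Omega[OF assms] intro!: closed_Collect_le continuous_on_absum)
  ultimately have "compact (B \<inter> {x \<in> Omega d T K. absum d T x \<le> R})"
    by (rule compact_Int_closed)
  moreover have "{x \<in> Omega d T K. absum d T x \<le> R} \<subseteq> B"
  proof
    fix x assume x: "x \<in> {x \<in> Omega d T K. absum d T x \<le> R}"
    have "\<bar>x (t, j)\<bar> \<le> \<bar>R\<bar>" for t j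
    proof (cases "t \<le> T \<and> j \<in> {1..d}")
      case True then show ?thesis using coord_le_absum[of t T j d x] x by auto
    next
      case False then have "x (t, j) = 0" using x by (auto simp: Omega_def)
      then show ?thesis by simp
    qed
    then show "x \<in> B" by (auto simp: B_def abs_le_iff minus_le_iff)
  qed
  ultimately show ?thesis by (simp add: inf.absorb2)
qed

text \<open>On Omega the coordinates up to time T determine the point, since all others are 0; hence
  the dependence clause is vacuous at t = T.\<close>

lemma Cspace_T_iff:
  "g \<in> Cspace d T K T \<longleftrightarrow> continuous_on (Omega d T K) g \<and> (\<forall>x. x \<notin> Omega d T K \<longrightarrow> g x = 0) \<and>
    (\<exists>M. \<forall>x\<in>Omega d T K. \<bar>g x\<bar> \<le> M * (1 + absum d T x))"
proof -
  have "x = y" if "x \<in> Omega d T K" "y \<in> Omega d T K" "\<forall>s\<le>T. \<forall>j\<in>{1..d}. x (s, j) = y (s, j)" for x y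
  proof
    fix i show "x i = y i"
      using that by (cases i; cases "fst i \<le> T \<and> snd i \<in> {1..d}") (auto simp: Omega_def)
  qed
  then have dep: "\<forall>x\<in>Omega d T K. \<forall>y\<in>Omega d T K.
      (\<forall>s\<le>T. \<forall>j\<in>{1..d}. x (s, j) = y (s, j)) \<longrightarrow> g x = g y"
    by blast
  have iff: "P \<and> R \<and> D \<and> B \<longleftrightarrow> P \<and> R \<and> B" if D for P R D B using that by blast
  show ?thesis unfolding Cspace_def mem_Collect_eq using dep by (rule iff)
qed

lemma Cspace_bound:
  assumes "g \<in> Cspace d T K T"
  obtains M where "0 < M" "\<And>x. x \<in> Omega d T K \<Longrightarrow> \<bar>g x\<bar> \<le> M * (1 + absum d T x)"
proof -
  obtain M where M: "\<And>x. x \<in> Omega d T K \<Longrightarrow> \<bar>g x\<bar> \<le> M * (1 + absum d T x)"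
    using assms by (auto simp: Cspace_T_iff)
  have "\<bar>g x\<bar> \<le> max 1 M * (1 + absum d T x)" if "x \<in> Omega d T K" for x
    using M[OF that] absum_nonneg[of d T x] by (meson add_nonneg_nonneg max.cobounded2 mult_right_mono order_trans zero_le_one)
  then show thesis by (intro that[of "max 1 M"]) auto
qed

lemma Cspace_mono:
  assumes "t \<le> T" shows "Cspace d T K t \<subseteq> Cspace d T K T"
proof
  fix g assume g: "g \<in> Cspace d T K t"
  then obtain M where M: "\<And>x. x \<in> Omega d T K \<Longrightarrow> \<bar>g x\<bar> \<le> M * (1 + absum d t x)"
    unfolding Cspace_def by blast
  have "\<bar>g x\<bar> \<le> \<bar>M\<bar> * (1 + absum d T x)" if "x \<in> Omega d T K" for x
  proof -
    have "M * (1 + absum d t x) \<le> \<bar>M\<bar> * (1 + absum d T x)"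
      using absum_mono[OF assms, of d x] absum_nonneg[of d t x] by (intro mult_mono) auto
    with M[OF that] show ?thesis by linarith
  qed
  moreover have "continuous_on (Omega d T K) g" "\<forall>x. x \<notin> Omega d T K \<longrightarrow> g x = 0"
    using g unfolding Cspace_def by blast+
  ultimately show "g \<in> Cspace d T K T" unfolding Cspace_T_iff by blast
qed

lemma Cspace_lin:
  assumes f: "f \<in> Cspace d T K T" and g: "g \<in> Cspace d T K T"
  shows "(\<lambda>x. a * f x + b * g x) \<in> Cspace d T K T"
proof -
  obtain M where M: "0 < M" "\<And>x. x \<in> Omega d T K \<Longrightarrow> \<bar>f x\<bar> \<le> M * (1 + absum d T x)"
    using Cspace_bound[OF f] by blast
  obtain M' where M': "0 < M'" "\<And>x. x \<in> Omega d T K \<Longrightarrow> \<bar>g x\<bar> \<le> M' * (1 + absum d T x)"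
    using Cspace_bound[OF g] by blast
  have "\<bar>a * f x + b * g x\<bar> \<le> (\<bar>a\<bar> * M + \<bar>b\<bar> * M') * (1 + absum d T x)" if x: "x \<in> Omega d T K" for x
  proof -
    have "\<bar>a * f x + b * g x\<bar> \<le> \<bar>a\<bar> * \<bar>f x\<bar> + \<bar>b\<bar> * \<bar>g x\<bar>"
      by (metis abs_mult abs_triangle_ineq)
    also have "\<dots> \<le> \<bar>a\<bar> * (M * (1 + absum d T x)) + \<bar>b\<bar> * (M' * (1 + absum d T x))"
      using M(2)[OF x] M'(2)[OF x] by (intro add_mono mult_left_mono) auto
    finally show ?thesis by (simp add: algebra_simps)
  qed
  moreover have "continuous_on (Omega d T K) (\<lambda>x. a * f x + b * g x)"
    using f g by (intro continuous_intros) (auto simp: Cspace_T_iff)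
  ultimately show ?thesis using f g by (auto simp: Cspace_T_iff)
qed

lemma Cspace_max:
  assumes f: "f \<in> Cspace d T K T" and g: "g \<in> Cspace d T K T"
  shows "(\<lambda>x. max (f x) (g x)) \<in> Cspace d T K T"
proof -
  obtain M where M: "0 < M" "\<And>x. x \<in> Omega d T K \<Longrightarrow> \<bar>f x\<bar> \<le> M * (1 + absum d T x)"
    using Cspace_bound[OF f] by blast
  obtain M' where M': "0 < M'" "\<And>x. x \<in> Omega d T K \<Longrightarrow> \<bar>g x\<bar> \<le> M' * (1 + absum d T x)"
    using Cspace_bound[OF g] by blast
  have "\<bar>max (f x) (g x)\<bar> \<le> (M + M') * (1 + absum d T x)" if x: "x \<in> Omega d T K" for x
    using M(2)[OF x] M'(2)[OF x] by (auto simp: distrib_right)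
  moreover have "continuous_on (Omega d T K) (\<lambda>x. max (f x) (g x))"
    using f g by (intro continuous_intros) (auto simp: Cspace_T_iff)
  ultimately show ?thesis using f g by (auto simp: Cspace_T_iff)
qed

lemma Cspace_restrictI:
  assumes "continuous_on (Omega d T K) g" "\<And>x. x \<in> Omega d T K \<Longrightarrow> \<bar>g x\<bar> \<le> M * (1 + absum d T x)"
  shows "(\<lambda>x. indicator (Omega d T K) x * g x) \<in> Cspace d T K T"
proof -
  have "continuous_on (Omega d T K) (\<lambda>x. indicator (Omega d T K) x * g x)"
    using assms(1) by (rule continuous_on_eq) simp
  then show ?thesis using assms(2) by (auto simp: Cspace_T_iff intro!: exI[of _ M])
qed

lemma Cspace_indicator: "indicator (Omega d T K) \<in> Cspace d T K T"
  using Cspace_restrictI[of d T K "\<lambda>x. 1" 1] absum_nonneg[of d T] by simp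

lemma Cspace_weight: "(\<lambda>x. indicator (Omega d T K) x * (1 + absum d T x)) \<in> Cspace d T K T"
  using absum_nonneg[of d T]
  by (intro Cspace_restrictI[of _ _ _ _ 1] continuous_intros continuous_on_absum) auto

lemma Cspace_measurable:
  assumes "closed (Omega d T K)" "g \<in> Cspace d T K T"
  shows "g \<in> borel_measurable borel"
proof -
  have "(\<lambda>x. indicator (Omega d T K) x *\<^sub>R g x) \<in> borel_measurable borel"
    using assms by (intro borel_measurable_continuous_on_indicator) (auto simp: Cspace_T_iff)
  also have "(\<lambda>x. indicator (Omega d T K) x *\<^sub>R g x) = g"
    using assms(2) by (intro ext) (auto simp: Cspace_T_iff indicator_def)
  finally show ?thesis .
qed

text \<open>The distance to the complement of G, capped at 1 to meet the growth bound.\<close>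

lemma Cspace_opens:
  assumes "open G"
  shows "\<exists>h\<in>Cspace d T K T. (\<forall>x. 0 \<le> h x) \<and> {x. 0 < h x} = G \<inter> Omega d T K"
\<comment> \<open>\<open>infdist\<close> to the empty set is 0, so the whole space needs its own
  witness.\<close>
proof (cases "G = UNIV")
  case True
  then show ?thesis
    by (intro bexI[OF _ Cspace_indicator]) (auto simp: indicator_def of_bool_def split: if_splits)
next
  case False
  define h where "h = (\<lambda>x. indicator (Omega d T K) x * min 1 (infdist x (- G)))"
  have "h \<in> Cspace d T K T"
    unfolding h_def using absum_nonneg[of d T]
    by (intro Cspace_restrictI[of _ _ _ _ 1] continuous_intros) (auto simp: infdist_nonneg min.coboundedI1)
  moreover have "0 < infdist x (- G) \<longleftrightarrow> x \<in> G" for x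
    using in_closed_iff_infdist_zero[of "- G" x] assms False infdist_nonneg[of x "- G"]
    by (auto simp: closed_def less_le)
  ultimately show ?thesis
    by (intro bexI[of _ h]) (auto simp: h_def infdist_nonneg indicator_def of_bool_def split: if_splits)
qed

section \<open>Superhedging values and duality\<close>

locale superhedging =
  fixes d T :: nat
    and K :: "nat \<Rightarrow> nat \<Rightarrow> real set"
    and E :: "nat \<Rightarrow> fn set"
    and U :: "(nat \<Rightarrow> fn) \<Rightarrow> ereal"
    and A :: "fn set"
    and KK :: "nat \<Rightarrow> nat \<Rightarrow> (nat \<Rightarrow> real) set"
    and f :: "nat \<Rightarrow> nat \<Rightarrow> fn"
  assumes Kclosed: "\<forall>t\<le>T. \<forall>j\<in>{1..d}. closed (K t j)"
    and Esub: "\<forall>t\<le>T. E t \<subseteq> Cspace d T K t"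
    and Eadd: "\<forall>t\<le>T. \<forall>\<phi>\<in>E t. \<forall>\<psi>\<in>E t. (\<lambda>x. \<phi> x + \<psi> x) \<in> E t"
    and Esmult: "\<forall>t\<le>T. \<forall>\<phi>\<in>E t. \<forall>r::real. (\<lambda>x. r * \<phi> x) \<in> E t"
    and Econst: "\<forall>t\<le>T. \<forall>k::real. cst (Omega d T K) k \<in> E t"
    and Ufin: "\<forall>\<phi>\<in>Ecal T E. U \<phi> < \<infinity>"
    and Uconc: "\<forall>\<phi>\<in>Ecal T E. \<forall>\<psi>\<in>Ecal T E. \<forall>l\<in>{0<..<(1::real)}.
                  ereal l * U \<phi> + ereal (1 - l) * U \<psi>
                  \<le> U (\<lambda>t x. l * \<phi> t x + (1 - l) * \<psi> t x)"
    and U0: "U (\<lambda>t x. 0) \<noteq> -\<infinity>"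
    and Asub: "A \<subseteq> Cspace d T K T"
    and A0: "(\<lambda>x. 0) \<in> A"
    and Acone: "\<forall>a\<in>A. \<forall>b\<in>A. \<forall>r\<ge>0. \<forall>s\<ge>0. (\<lambda>x. r * a x + s * b x) \<in> A"
    and KKcompact: "\<forall>t\<le>T. \<forall>n\<ge>1. compact (KK t n)"
    and fE: "\<forall>t\<le>T. \<forall>n\<ge>1. f t n \<in> E t"
    and fnonneg: "\<forall>t\<le>T. \<forall>n\<ge>1. \<forall>x\<in>Omega d T K. 0 \<le> f t n x"
    and fdom: "\<forall>n\<ge>1. \<forall>x\<in>Omega d T K. \<not> (\<forall>t\<le>T. (\<lambda>j. x (t,j)) \<in> KK t n) \<longrightarrow>
                  1 + absum d T x \<le> (\<Sum>t\<le>T. f t n x)"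
    and fV: "\<forall>\<Gamma>>0. (\<lambda>n. Vfun U (\<lambda>t. if t \<le> T then (\<lambda>x. \<Gamma> * f t n x) else (\<lambda>x. 0)))
                  \<longlonglongrightarrow> 0"
begin

abbreviation "Om \<equiv> Omega d T K"
abbreviation "C \<equiv> Cspace d T K T"
abbreviation "P \<equiv> Pfrak T Om E U A"

definition w :: "pt \<Rightarrow> real" where "w x = 1 + absum d T x"

text \<open>Here \<open>\<psi> = \<phi> + \<beta>\<close>, \<open>b = \<Sum>\<beta>\<^sub>t\<close> and \<open>a = -z\<close> in terms of the definition of \<open>\<P>(c)\<close>.\<close>

definition feasible :: "(pt \<Rightarrow> ereal) \<Rightarrow> (nat \<Rightarrow> fn) \<Rightarrow> real \<Rightarrow> fn \<Rightarrow> bool" where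
  "feasible c \<psi> b a \<longleftrightarrow> \<psi> \<in> Ecal T E \<and> a \<in> A \<and>
     (\<forall>x\<in>Om. ereal ((\<Sum>t\<le>T. \<psi> t x) - b - a x) \<le> c x)"

lemma w_ge_1: "1 \<le> w x"
  using absum_nonneg[of d T x] by (simp add: w_def)

lemma Ecal_lin:
  assumes "\<phi> \<in> Ecal T E" "\<psi> \<in> Ecal T E"
  shows "(\<lambda>t x. r * \<phi> t x + s * \<psi> t x) \<in> Ecal T E"
  using assms Eadd Esmult unfolding Ecal_def by auto

lemma Ecal_scale:
  assumes "\<phi> \<in> Ecal T E" shows "(\<lambda>t x. r * \<phi> t x) \<in> Ecal T E"
  using assms Esmult unfolding Ecal_def by auto

lemma Ecal_uminus:
  assumes "\<phi> \<in> Ecal T E" shows "(\<lambda>t x. - \<phi> t x) \<in> Ecal T E"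
  using Ecal_scale[OF assms, of "-1"] by simp

lemma Ecal_zero: "(\<lambda>t x. 0) \<in> Ecal T E"
proof -
  have "(\<lambda>x. 0) \<in> E t" if "t \<le> T" for t
    using Econst[rule_format, OF that, of 0] by (simp add: cst_def)
  then show ?thesis by (auto simp: Ecal_def)
qed

lemma Ecal_C: "\<phi> \<in> Ecal T E \<Longrightarrow> t \<le> T \<Longrightarrow> \<phi> t \<in> C"
  using Esub Cspace_mono[of t T d K] unfolding Ecal_def by blast

lemma Cspace_zero: "(\<lambda>x. 0) \<in> C"
  using Cspace_lin[OF Cspace_indicator Cspace_indicator, of 0 d T K 0] by simp

lemma Ecal_sum_C: 
  assumes "\<phi> \<in> Ecal T E" shows "(\<lambda>x. \<Sum>t\<le>T. \<phi> t x) \<in> C"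
proof -
  have "(\<lambda>x. \<Sum>t\<in>I. \<phi> t x) \<in> C" if "finite I" "I \<subseteq> {..T}" for I
    using that
  proof (induction I)
    case (insert t I)
    then show ?case
      using Cspace_lin[OF Ecal_C[OF assms, of t], of "\<lambda>x. \<Sum>t\<in>I. \<phi> t x" 1 1] by simp
  qed (simp add: Cspace_zero)
  then show ?thesis by simp
qed

section \<open>The value as a supremum over feasible triples\<close>

lemma shift_Ecal:
  assumes "\<phi> \<in> Ecal T E" shows "shift T Om \<phi> \<beta> \<in> Ecal T E"
  using assms Eadd Econst unfolding Ecal_def shift_def by auto

lemma shift_sum: "x \<in> Om \<Longrightarrow> (\<Sum>t\<le>T. shift T Om \<phi> \<beta> t x) = (\<Sum>t\<le>T. \<phi> t x) + (\<Sum>t\<le>T. \<beta> t)"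
  by (simp add: shift_def cst_def sum.distrib)

text \<open>Undoing a shift of total b turns \<psi> into a member of \<open>Phi\<close>. Its
  membership in \<open>domSU\<close> is witnessed by U(\<psi>) - b, which is why the value -infinity
  is split off.\<close>

lemma P_upper:
  assumes "feasible c \<psi> b a" shows "U \<psi> - ereal b \<le> P c"
proof (cases "U \<psi> = -\<infinity>")
  case True then show ?thesis by simp
next
  case False
  note F = assms[unfolded feasible_def]
  \<comment> \<open>Only the total of \<beta> matters, so all of b is placed at time 0.\<close>
  define \<beta> where "\<beta> = (\<lambda>t::nat. if t = 0 then b else 0)"
  define \<phi> where "\<phi> = shift T Om \<psi> (\<lambda>t. - \<beta> t)"
  have sb: "(\<Sum>t\<le>T. \<beta> t) = b" by (simp add: \<beta>_def sum.delta')
  have "shift T Om \<phi> \<beta> = \<psi>"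
    using F by (intro ext) (auto simp: \<phi>_def shift_def cst_def Ecal_def)
  then have "U \<psi> - ereal b \<le> SU T Om U \<phi>"
    unfolding SU_def by (intro SUP_upper2[of \<beta>]) (auto simp: sb)
  moreover have "-\<infinity> < U \<psi> - ereal b" using False by (cases "U \<psi>") auto
  ultimately have "\<phi> \<in> domSU T Om E U"
    using shift_Ecal F by (auto simp: domSU_def \<phi>_def)
  moreover have "(\<Sum>t\<le>T. \<phi> t x) = (\<Sum>t\<le>T. \<psi> t x) - b" if "x \<in> Om" for x
    unfolding \<phi>_def shift_sum[OF that] by (simp add: sum_negf sb)
  ultimately have "\<phi> \<in> Phi T Om E U (- a) c"
    using F by (auto simp: Phi_def)
  then have "SU T Om U \<phi> \<le> P c"
    unfolding Pfrak_def using F by (intro SUP_upper2[of "- a"] SUP_upper) auto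
  with \<open>U \<psi> - ereal b \<le> SU T Om U \<phi>\<close> show ?thesis by (rule order_trans)
qed

text \<open>The other half of the reformulation: each \<beta> in the supremum defining
  \<open>SU\<close> gives a feasible triple.\<close>

lemma P_least:
  assumes "\<And>\<psi> b a. feasible c \<psi> b a \<Longrightarrow> U \<psi> - ereal b \<le> y"
  shows "P c \<le> y"
  unfolding Pfrak_def
proof (intro SUP_least)
  fix z \<phi> assume z: "z \<in> uminus ` A" and \<phi>: "\<phi> \<in> Phi T Om E U z c"
  obtain a where a: "a \<in> A" "z = - a" using z by blast
  show "SU T Om U \<phi> \<le> y"
    unfolding SU_def
  proof (rule SUP_least)
    fix \<beta> :: "nat \<Rightarrow> real"
    have "feasible c (shift T Om \<phi> \<beta>) (\<Sum>t\<le>T. \<beta> t) a"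
      using \<phi> a by (auto simp: feasible_def Phi_def domSU_def shift_Ecal shift_sum)
    then show "U (shift T Om \<phi> \<beta>) - ereal (\<Sum>t\<le>T. \<beta> t) \<le> y" by (rule assms)
  qed
qed

lemma P_approx:
  assumes "ereal r < P c"
  obtains \<psi> b a u where "feasible c \<psi> b a" "U \<psi> = ereal u" "r < u - b"
proof -
  have "\<exists>\<psi> b a. feasible c \<psi> b a \<and> ereal r < U \<psi> - ereal b"
  proof (rule ccontr)
    assume "\<not> ?thesis"
    then have "P c \<le> ereal r" by (intro P_least) (auto simp: not_less)
    with assms show False by simp
  qed
  then obtain \<psi> b a where *: "feasible c \<psi> b a" "ereal r < U \<psi> - ereal b" by blast
  then have "U \<psi> < \<infinity>" using Ufin by (auto simp: feasible_def)
  with *(2) obtain u where "U \<psi> = ereal u" by (cases "U \<psi>") auto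
  with * show thesis by (intro that) auto
qed

text \<open>A feasible triple for c becomes one for c' by lowering b by k and adding a to its cone
  part. Monotonicity, cash additivity and all sign properties of the supergradient are
  instances.\<close>

lemma P_transfer:
  assumes a: "a \<in> A"
    and le: "\<And>x s. x \<in> Om \<Longrightarrow> ereal s \<le> c x \<Longrightarrow> ereal (s + k - a x) \<le> c' x"
  shows "P c + ereal k \<le> P c'"
proof -
  have "P c \<le> P c' - ereal k"
  proof (rule P_least)
    fix \<psi> b a' assume F: "feasible c \<psi> b a'"
    have "(\<lambda>x. 1 * a' x + 1 * a x) \<in> A"
      using Acone a F unfolding feasible_def by (meson zero_le_one)
    then have "(\<lambda>x. a' x + a x) \<in> A" by simp
    moreover have "ereal ((\<Sum>t\<le>T. \<psi> t x) - (b - k) - (a' x + a x)) \<le> c' x" if "x \<in> Om" for x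
      using le[OF that, of "(\<Sum>t\<le>T. \<psi> t x) - b - a' x"] F that
      by (simp add: feasible_def algebra_simps)
    ultimately have "feasible c' \<psi> (b - k) (\<lambda>x. a' x + a x)"
      using F by (simp add: feasible_def)
    from P_upper[OF this] show "U \<psi> - ereal b \<le> P c' - ereal k"
      by (cases "U \<psi>"; cases "P c'") auto
  qed
  then show ?thesis by (cases "P c"; cases "P c'") auto
qed

lemma P_mono: "(\<And>x. x \<in> Om \<Longrightarrow> c x \<le> c' x) \<Longrightarrow> P c \<le> P c'"
  using P_transfer[OF A0, of c 0 c'] order_trans[of _ "c _" "c' _"] by (simp add: zero_ereal_def[symmetric])

text \<open>Convex combinations of near-optimal triples are feasible. Strict real lower bounds r, r'
  replace the values themselves, so the statement also covers infinite values.\<close>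

lemma P_concave_lower:
  assumes l: "0 < l" "l < 1" and r: "ereal r < P c" and r': "ereal r' < P c'"
    and le: "\<And>x s s'. x \<in> Om \<Longrightarrow> ereal s \<le> c x \<Longrightarrow> ereal s' \<le> c' x \<Longrightarrow>
      ereal (l * s + (1 - l) * s') \<le> c'' x"
  shows "ereal (l * r + (1 - l) * r') \<le> P c''"
proof -
  obtain \<psi> b a u where 1: "feasible c \<psi> b a" "U \<psi> = ereal u" "r < u - b" using P_approx[OF r] .
  obtain \<psi>' b' a' u' where 2: "feasible c' \<psi>' b' a'" "U \<psi>' = ereal u'" "r' < u' - b'" using P_approx[OF r'] .
  let ?\<psi> = "\<lambda>t x. l * \<psi> t x + (1 - l) * \<psi>' t x" and ?b = "l * b + (1 - l) * b'"
  have "(\<lambda>x. l * a x + (1 - l) * a' x) \<in> A"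
    using Acone 1 2 l unfolding feasible_def by (meson diff_ge_0_iff_ge less_imp_le)
  moreover have "ereal ((\<Sum>t\<le>T. ?\<psi> t x) - ?b - (l * a x + (1 - l) * a' x)) \<le> c'' x" if x: "x \<in> Om" for x
  proof -
    have "ereal (l * ((\<Sum>t\<le>T. \<psi> t x) - b - a x) + (1 - l) * ((\<Sum>t\<le>T. \<psi>' t x) - b' - a' x)) \<le> c'' x"
      using 1(1) 2(1) x by (intro le) (auto simp: feasible_def)
    moreover have "(\<Sum>t\<le>T. ?\<psi> t x) = l * (\<Sum>t\<le>T. \<psi> t x) + (1 - l) * (\<Sum>t\<le>T. \<psi>' t x)"
      by (simp add: sum.distrib sum_distrib_left)
    then have "(\<Sum>t\<le>T. ?\<psi> t x) - ?b - (l * a x + (1 - l) * a' x)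
        = l * ((\<Sum>t\<le>T. \<psi> t x) - b - a x) + (1 - l) * ((\<Sum>t\<le>T. \<psi>' t x) - b' - a' x)"
      by (simp only:) (simp add: algebra_simps)
    ultimately show ?thesis by (simp only:)
  qed
  ultimately have "feasible c'' ?\<psi> ?b (\<lambda>x. l * a x + (1 - l) * a' x)"
    using 1(1) 2(1) Ecal_lin by (simp add: feasible_def)
  from P_upper[OF this] have "U ?\<psi> - ereal ?b \<le> P c''" .
  moreover have "ereal (l * u + (1 - l) * u') \<le> U ?\<psi>"
    using Uconc[rule_format, of \<psi> \<psi>' l] 1 2 l by (auto simp: feasible_def)
  ultimately have "ereal (l * u + (1 - l) * u' - ?b) \<le> P c''"
    by (cases "U ?\<psi>"; cases "P c''") auto
  moreover have "l * r + (1 - l) * r' \<le> l * u + (1 - l) * u' - ?b"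
  proof -
    have "l * r + (1 - l) * r' \<le> l * (u - b) + (1 - l) * (u' - b')"
      using 1(3) 2(3) l by (intro add_mono mult_left_mono) auto
    then show ?thesis by (simp add: algebra_simps)
  qed
  ultimately show ?thesis by (meson ereal_less_eq(3) order_trans)
qed

lemma P_concave:
  assumes l: "0 < l" "l < 1" and r: "P c = ereal r" and r': "P c' = ereal r'"
    and le: "\<And>x s s'. x \<in> Om \<Longrightarrow> ereal s \<le> c x \<Longrightarrow> ereal s' \<le> c' x \<Longrightarrow>
      ereal (l * s + (1 - l) * s') \<le> c'' x"
  shows "ereal (l * r + (1 - l) * r') \<le> P c''"
proof (rule ereal_le_epsilon2)
  fix e :: real assume "0 < e"
  then have "ereal (l * (r - e) + (1 - l) * (r' - e)) \<le> P c''"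
    using r r' by (intro P_concave_lower[OF l _ _ le]) auto
  also have "l * (r - e) + (1 - l) * (r' - e) = l * r + (1 - l) * r' - e"
    by (simp add: algebra_simps)
  finally show "ereal (l * r + (1 - l) * r') \<le> P c'' + ereal e"
    by (cases "P c''") auto
qed

text \<open>A tool for finiteness: an infinite value at one end of a segment passes to its midpoint
  unless the other end has value -infinity.\<close>

lemma P_infinite:
  assumes r: "P c = \<infinity>" and r': "P c' \<noteq> -\<infinity>"
    and le: "\<And>x s s'. x \<in> Om \<Longrightarrow> ereal s \<le> c x \<Longrightarrow> ereal s' \<le> c' x \<Longrightarrow>
      ereal (1/2 * s + 1/2 * s') \<le> c'' x"
  shows "P c'' = \<infinity>"
proof (rule ereal_top)
  fix B :: real
  obtain s where s: "ereal s < P c'"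
    using r' by (metis ereal_dense2 ereal_infty_less(2))
  \<comment> \<open>The lower bound 2B - s at c is chosen so that the midpoint with s is B.\<close>
  have "ereal (1/2 * (2 * B - s) + (1 - 1/2) * s) \<le> P c''"
    using r s le by (intro P_concave_lower[of "1/2" _ c _ c']) auto
  then show "ereal B \<le> P c''" by (simp add: algebra_simps)
qed

text \<open>The family -\<Gamma> f^n; as V(\<phi>) = -U(-\<phi>), assumption (ii) says that its
  utility tends to 0.\<close>

definition penalty :: "real \<Rightarrow> nat \<Rightarrow> nat \<Rightarrow> fn" where
  "penalty \<Gamma> n = (\<lambda>t x. - (if t \<le> T then \<Gamma> * f t n x else 0))"

lemma penalty_Ecal: "1 \<le> n \<Longrightarrow> penalty \<Gamma> n \<in> Ecal T E"
  using fE Esmult[rule_format, of _ _ "- \<Gamma>"] by (auto simp: penalty_def Ecal_def)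

lemma penalty_sum: "(\<Sum>t\<le>T. penalty \<Gamma> n t x) = - \<Gamma> * (\<Sum>t\<le>T. f t n x)"
  by (simp add: penalty_def sum_distrib_left sum_negf)

lemma U_penalty:
  assumes "0 < \<Gamma>" shows "\<forall>\<^sub>F n in sequentially. U (penalty \<Gamma> n) > ereal (-1)"
proof -
  have eq: "Vfun U (\<lambda>t. if t \<le> T then (\<lambda>x. \<Gamma> * f t n x) else (\<lambda>x. 0)) = - U (penalty \<Gamma> n)" for n
    unfolding Vfun_def penalty_def by (intro arg_cong[of _ _ uminus] arg_cong[of _ _ U] ext) simp
  have "(\<lambda>n. - U (penalty \<Gamma> n)) \<longlonglongrightarrow> 0"
    using fV[rule_format, OF assms] unfolding eq .
  from order_tendstoD(2)[OF this, of 1] show ?thesis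
    by (simp add: ereal_uminus_less_reorder one_ereal_def)
qed

text \<open>Replaces the product of compact sets by a sublevel set of \<open>absum\<close>, the form
  in which growth bounds and compactness of subsets of Omega are available.\<close>

lemma compact_bound:
  assumes "1 \<le> n"
  obtains R where "\<And>x. x \<in> Om \<Longrightarrow> \<forall>t\<le>T. (\<lambda>j. x (t, j)) \<in> KK t n \<Longrightarrow> absum d T x \<le> R"
proof -
  have "\<exists>B. \<forall>y\<in>KK t n. \<bar>y j\<bar> \<le> B" if "t \<le> T" for t j
  proof -
    have "compact ((\<lambda>y. y j) ` KK t n)"
      using KKcompact that assms
      by (intro compact_continuous_image continuous_on_subset[OF continuous_on_product_coordinates]) auto
    then show ?thesis using compact_imp_bounded by (force simp: bounded_real)
  qed
  then obtain B where B: "\<And>t j y. t \<le> T \<Longrightarrow> y \<in> KK t n \<Longrightarrow> \<bar>y j\<bar> \<le> B t j" by metis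
  have "absum d T x \<le> (\<Sum>s\<le>T. \<Sum>j=1..d. B s j)" if "\<forall>t\<le>T. (\<lambda>j. x (t, j)) \<in> KK t n" for x
    unfolding absum_def using B[of _ "\<lambda>j. x (_, j)"] that by (intro sum_mono) auto
  then show thesis by (intro that)
qed

text \<open>The penalty with b = \<Gamma> (1 + |R|) is feasible: off the compact product w is at
  most the sum of the f^n_t, and on it w is at most 1 + |R|.\<close>

lemma P_lower:
  assumes c: "\<And>x. x \<in> Om \<Longrightarrow> ereal (- M * w x) \<le> c x"
  shows "P c \<noteq> -\<infinity>"
proof -
  \<comment> \<open>M may be nonpositive, whereas assumption (ii) speaks of positive
    \<Gamma>.\<close>
  define \<Gamma> where "\<Gamma> = max M 1"
  have G: "0 < \<Gamma>" "M \<le> \<Gamma>" by (auto simp: \<Gamma>_def)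
  have "\<forall>\<^sub>F n in sequentially. 1 \<le> n \<and> U (penalty \<Gamma> n) > ereal (-1)"
    using U_penalty[OF G(1)] eventually_ge_at_top[of 1] by eventually_elim auto
  then obtain n where n: "1 \<le> n" "U (penalty \<Gamma> n) > ereal (-1)"
    by (auto simp: eventually_sequentially)
  obtain R where R: "\<And>x. x \<in> Om \<Longrightarrow> \<forall>t\<le>T. (\<lambda>j. x (t, j)) \<in> KK t n \<Longrightarrow> absum d T x \<le> R"
    using compact_bound[OF n(1)] by blast
  define b where "b = \<Gamma> * (1 + \<bar>R\<bar>)"
  have "feasible c (penalty \<Gamma> n) b (\<lambda>x. 0)"
    unfolding feasible_def
  proof (intro conjI ballI)
    fix x assume x: "x \<in> Om"
    have F0: "0 \<le> (\<Sum>t\<le>T. f t n x)" using fnonneg n x by (intro sum_nonneg) auto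
    have "\<Gamma> * w x \<le> \<Gamma> * ((\<Sum>t\<le>T. f t n x) + (1 + \<bar>R\<bar>))"
    proof (intro mult_left_mono)
      show "w x \<le> (\<Sum>t\<le>T. f t n x) + (1 + \<bar>R\<bar>)"
        using R[OF x] fdom n x F0 unfolding w_def by (cases "\<forall>t\<le>T. (\<lambda>j. x (t, j)) \<in> KK t n") fastforce+
    qed (use G in auto)
    moreover have "M * w x \<le> \<Gamma> * w x" using G w_ge_1[of x] by (intro mult_right_mono) auto
    ultimately have "(\<Sum>t\<le>T. penalty \<Gamma> n t x) - b - 0 \<le> - M * w x"
      unfolding penalty_sum b_def by (simp add: algebra_simps)
    then show "ereal ((\<Sum>t\<le>T. penalty \<Gamma> n t x) - b - 0) \<le> c x"
      using c[OF x] by (meson ereal_less_eq(3) order_trans)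
  qed (use penalty_Ecal[OF n(1)] A0 in auto)
  from P_upper[OF this] n(2) show ?thesis by (cases "U (penalty \<Gamma> n)") auto
qed

section \<open>Expectations of lower semicontinuous functions\<close>

lemma continuous_on_w: "continuous_on S w"
  unfolding w_def[abs_def] by (intro continuous_intros continuous_on_absum)

lemma C_w: "(\<lambda>x. indicator Om x * w x) \<in> C"
  using Cspace_weight[of d T K] by (simp add: w_def)

lemma closed_Om: "closed Om" by (rule closed_Omega[OF Kclosed])

lemma C_bound:
  assumes "g \<in> C"
  obtains M where "0 < M" "\<And>x. x \<in> Om \<Longrightarrow> \<bar>g x\<bar> \<le> M * w x"
  using Cspace_bound[OF assms] by (auto simp: w_def)

lemma Prob1_facts:
  assumes Q: "Q \<in> Prob1 d T K"
  shows "AE x in Q. x \<in> Om" "integrable Q w" "\<And>g. g \<in> C \<Longrightarrow> integrable Q g" "prob_space Q"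
    "sets Q = sets borel" "Om \<noteq> {}" "space Q = UNIV"
proof -
  interpret prob_space Q using Q by (auto simp: Prob1_def)
  show "prob_space Q" by (rule prob_space_axioms)
  show sQ [measurable_cong]: "sets Q = sets borel" using Q by (auto simp: Prob1_def)
  show sp: "space Q = UNIV" using sets_eq_imp_space_eq[OF sQ] by simp
  have Om: "Om \<in> sets Q" using closed_Om sQ by auto
  have OmQ: "emeasure Q Om = 1" using Q by (auto simp: Prob1_def)
  then show "Om \<noteq> {}" by auto
  show ae: "AE x in Q. x \<in> Om"
    using OmQ Om by (intro AE_I_eq_1) (auto simp: sp)
  have "integrable Q (\<lambda>x. \<Sum>s\<le>T. \<Sum>j=1..d. \<bar>x (s, j)\<bar>)"
    using Q by (intro Bochner_Integration.integrable_sum integrable_abs) (auto simp: Prob1_def)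
  then show iw: "integrable Q w"
    unfolding w_def[abs_def] absum_def by (intro Bochner_Integration.integrable_add) auto
  show "integrable Q g" if g: "g \<in> C" for g
  proof -
    obtain M where M: "0 < M" "\<And>x. x \<in> Om \<Longrightarrow> \<bar>g x\<bar> \<le> M * w x" using C_bound[OF g] by blast
    have "integrable Q (\<lambda>x. M * w x)" using iw by simp
    then show ?thesis
    proof (rule Bochner_Integration.integrable_bound)
      show "g \<in> borel_measurable Q"
        using Cspace_measurable[OF closed_Om g] by (simp add: measurable_cong_sets[OF sQ refl])
      show "AE x in Q. norm (g x) \<le> norm (M * w x)"
        using ae by eventually_elim (use M in fastforce)
    qed
  qed
qed

text \<open>The negative part of c is at most M w, hence integrable, so E[c] reduces to the integral
  of a nonnegative function, to which monotone convergence applies.\<close>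

lemma ExpQ_shift:
  assumes Q: "Q \<in> Prob1 d T K" and M: "0 \<le> M"
    and u: "u \<in> borel_measurable borel" "\<And>x. 0 \<le> u x" "\<And>x. x \<in> Om \<Longrightarrow> u x = c x + ereal (M * w x)"
  shows "ExpQ Q c = enn2ereal (\<integral>\<^sup>+ x. e2ennreal (u x) \<partial>Q) - ereal (M * integral\<^sup>L Q w)"
proof -
  note F = Prob1_facts[OF Q]
  note [measurable_cong] = F(5)
  note [measurable] = u(1)
  have [measurable]: "w \<in> borel_measurable borel"
    by (intro borel_measurable_continuous_onI continuous_on_w)
  have w0: "0 \<le> w x" for x using w_ge_1[of x] by simp
  \<comment> \<open>Nothing is known about c off \<open>Om\<close>, so its positive and negative
    parts are replaced by Borel functions of u that agree with them on \<open>Om\<close>, hence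
    almost everywhere.\<close>
  define cp where "cp x = e2ennreal (u x - ereal (M * w x))" for x
  define cm where "cm x = e2ennreal (ereal (M * w x) - u x)" for x
  have c: "c x = u x - ereal (M * w x)" if "x \<in> Om" for x
    using u(3)[OF that] by (cases "c x") auto
  have cp: "(\<integral>\<^sup>+ x. e2ennreal (c x) \<partial>Q) = integral\<^sup>N Q cp"
    by (intro nn_integral_cong_AE) (use F(1) in eventually_elim, simp add: c cp_def)
  have mc: "- c x = ereal (M * w x) - u x" if "x \<in> Om" for x
    using u(3)[OF that] by (cases "c x") auto
  have cm: "(\<integral>\<^sup>+ x. e2ennreal (- c x) \<partial>Q) = integral\<^sup>N Q cm"
    by (intro nn_integral_cong_AE) (use F(1) in eventually_elim, simp add: mc cm_def)
  have [measurable]: "cp \<in> borel_measurable Q" "cm \<in> borel_measurable Q"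
    unfolding cp_def cm_def by measurable
  \<comment> \<open>Written additively, so that no infinite quantities are subtracted before
    integration.\<close>
  have eq: "cp x + ennreal (M * w x) = e2ennreal (u x) + cm x" for x
  proof (cases "u x")
    case (real r)
    have m: "0 \<le> M * w x" using M w0 by simp
    have r: "0 \<le> r" using u(2)[of x] real by simp
    show ?thesis
    proof (cases "r \<le> M * w x")
      case True
      then show ?thesis using m r real ennreal_plus[of r "M * w x - r"] by (simp add: cp_def cm_def ennreal_neg)
    next
      case False
      then show ?thesis using m r real ennreal_plus[of "r - M * w x" "M * w x"] by (simp add: cp_def cm_def ennreal_neg)
    qed
  qed (use u(2)[of x] in \<open>auto simp: cp_def cm_def\<close>)
  define i where "i = M * integral\<^sup>L Q w"
  have i0: "0 \<le> i" unfolding i_def using M w0 by (intro mult_nonneg_nonneg integral_nonneg) auto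
  have i: "(\<integral>\<^sup>+ x. ennreal (M * w x) \<partial>Q) = ennreal i"
    unfolding i_def using F(2) M w0 by (subst nn_integral_eq_integral) auto
  have "integral\<^sup>N Q cp + ennreal i = (\<integral>\<^sup>+ x. e2ennreal (u x) \<partial>Q) + integral\<^sup>N Q cm"
    unfolding i[symmetric] by (subst (1 2) nn_integral_add[symmetric]) (auto simp: eq)
  moreover have "integral\<^sup>N Q cm \<le> ennreal i"
    unfolding i[symmetric] cm_def
    by (intro nn_integral_mono) (metis e2ennreal_ereal e2ennreal_mono ereal_diff_le_self u(2))
  ultimately have "enn2ereal (integral\<^sup>N Q cp) - enn2ereal (integral\<^sup>N Q cm)
      = enn2ereal (\<integral>\<^sup>+ x. e2ennreal (u x) \<partial>Q) - ereal i"
    using i0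
    by (cases "integral\<^sup>N Q cp" rule: ennreal_cases; cases "integral\<^sup>N Q cm" rule: ennreal_cases;
        cases "\<integral>\<^sup>+ x. e2ennreal (u x) \<partial>Q" rule: ennreal_cases)
      (auto simp: ennreal_plus[symmetric] top_unique simp del: ennreal_plus)
  then show ?thesis by (simp add: ExpQ_def cp cm i_def)
qed

text \<open>Negative y is trivial because the shifted function is nonnegative; for the other y the
  continuous weight is moved to the left-hand side.\<close>

lemma lsc_add_weight:
  assumes lsc: "lsc_on Om c" and low: "\<forall>x\<in>Om. ereal (- M * w x) \<le> c x"
    and x: "x \<in> Om" and y: "y < c x + ereal (M * w x)"
  shows "\<forall>\<^sub>F x' in at x within Om. y < c x' + ereal (M * w x')"
proof -
  have inOm: "\<forall>\<^sub>F x' in at x within Om. x' \<in> Om"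
    by (simp add: eventually_at_filter)
  have nn: "0 \<le> c x + ereal (M * w x)" if "x \<in> Om" for x
    using low[rule_format, OF that] by (cases "c x") auto
  show ?thesis
  proof (cases "y < 0")
    case True
    show ?thesis using inOm by eventually_elim (use nn True in force)
  next
    case False
    then obtain r where r: "y = ereal r" using y by (cases y) auto
    have "ereal (r - M * w x) < c x" using y low[rule_format, OF x] r by (cases "c x") auto
    then obtain s where s: "r - M * w x < s" "ereal s < c x" using ereal_dense2 by force
    have "\<forall>\<^sub>F x' in at x within Om. ereal s < c x'" using lsc s x by (auto simp: lsc_on_def)
    moreover have "((\<lambda>x'. r - M * w x') \<longlongrightarrow> r - M * w x) (at x within Om)"
      using continuous_on_w[of Om] x by (intro tendsto_intros) (auto simp: continuous_on_def)
    then have "\<forall>\<^sub>F x' in at x within Om. r - M * w x' < s"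
      using s(1) by (rule order_tendstoD(2))
    ultimately show ?thesis
    proof eventually_elim
      fix x' assume "ereal s < c x'" "r - M * w x' < s"
      then show "y < c x' + ereal (M * w x')" by (cases "c x'") (auto simp: r)
    qed
  qed
qed

text \<open>The shifted function is nonnegative, so Lipschitz approximation applies; the n-th
  approximant is at most n on \<open>Om\<close>, and its cut-off to \<open>Om\<close> therefore has
  linear growth.\<close>

lemma lsc_approximation:
  assumes lsc: "lsc_on Om c" and low: "\<forall>x\<in>Om. ereal (- M * w x) \<le> c x" and ne: "Om \<noteq> {}"
  shows "\<exists>v :: nat \<Rightarrow> fn. (\<forall>n. v n \<in> C \<and> (\<forall>x. 0 \<le> v n x \<and> v n x \<le> v (Suc n) x)) \<and>
    (\<forall>x\<in>Om. (SUP n. ereal (v n x)) = c x + ereal (M * w x))"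
proof -
  have nn: "0 \<le> c x + ereal (M * w x)" if "x \<in> Om" for x
    using low[rule_format, OF that] by (cases "c x") auto
  obtain v :: "nat \<Rightarrow> fn" where v: "\<And>n. continuous_on UNIV (v n)" "\<And>n x. 0 \<le> v n x"
    "\<And>n x. x \<in> Om \<Longrightarrow> v n x \<le> real n" "\<And>n x. v n x \<le> v (Suc n) x"
    "\<And>x. x \<in> Om \<Longrightarrow> (SUP n. ereal (v n x)) = c x + ereal (M * w x)"
    using lsc_Lipschitz_approximation[of Om "\<lambda>x. c x + ereal (M * w x)", OF ne nn lsc_add_weight[OF lsc low]]
    by blast
  have "(\<lambda>x. indicator Om x * v n x) \<in> C" for n
  proof (rule Cspace_restrictI)
      show "continuous_on Om (v n)" using v(1) by (rule continuous_on_subset) simp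
      show "\<bar>v n x\<bar> \<le> real n * (1 + absum d T x)" if "x \<in> Om" for x
        using v(2)[of n x] v(3)[OF that, of n] absum_nonneg[of d T x] 
        by (simp add: algebra_simps add_increasing2)
  qed
  with v(2,4,5) show ?thesis
    by (intro exI[of _ "\<lambda>n x. indicator Om x * v n x"]) (auto simp: indicator_def)
qed

text \<open>A countable supremum of functions in \<open>C\<close> supplies a Borel representative of
  the shifted c, as \<open>ExpQ_shift\<close> requires.\<close>

lemma lsc_envelope:
  assumes "lsc_on Om c" "\<forall>x\<in>Om. ereal (- M * w x) \<le> c x" "Om \<noteq> {}"
  obtains u where "u \<in> borel_measurable borel" "\<And>x. 0 \<le> u x" "\<And>x. x \<in> Om \<Longrightarrow> u x = c x + ereal (M * w x)"
proof -
  obtain v :: "nat \<Rightarrow> fn" where v: "\<And>n. v n \<in> C" "\<And>n x. 0 \<le> v n x" "\<And>n x. v n x \<le> v (Suc n) x"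
    "\<And>x. x \<in> Om \<Longrightarrow> (SUP n. ereal (v n x)) = c x + ereal (M * w x)"
    using lsc_approximation[OF assms] by (elim exE conjE) blast
  note [measurable] = Cspace_measurable[OF closed_Om v(1)]
  show thesis
  proof (rule that[of "\<lambda>x. SUP n. ereal (v n x)"])
    show "(\<lambda>x. SUP n. ereal (v n x)) \<in> borel_measurable borel" by measurable
    show "0 \<le> (SUP n. ereal (v n x))" for x using v(2) by (intro SUP_upper2[of 0]) auto
  qed (use v in auto)
qed

lemma integral_le_ExpQ:
  assumes Q: "Q \<in> Prob1 d T K" and M: "0 \<le> M" and lsc: "lsc_on Om c"
    and low: "\<forall>x\<in>Om. ereal (- M * w x) \<le> c x"
    and s: "s \<in> C" "\<And>x. x \<in> Om \<Longrightarrow> ereal (s x) \<le> c x"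
  shows "ereal (integral\<^sup>L Q s) \<le> ExpQ Q c"
proof -
  note F = Prob1_facts[OF Q]
  obtain u where u: "u \<in> borel_measurable borel" "\<And>x. 0 \<le> u x" "\<And>x. x \<in> Om \<Longrightarrow> u x = c x + ereal (M * w x)"
    using lsc_envelope[OF lsc low F(6)] by blast
  \<comment> \<open>The same shift is applied to s, so that the comparison takes place between the
    nonnegative max(0, g) and u.\<close>
  define g where "g x = s x + M * w x" for x
  have g: "integrable Q g" unfolding g_def[abs_def] using F(2) F(3)[OF s(1)] by auto
  have "integral\<^sup>L Q g \<le> integral\<^sup>L Q (\<lambda>x. max 0 (g x))"
    using g by (intro integral_mono) auto
  also have "ereal \<dots> = enn2ereal (\<integral>\<^sup>+ x. ennreal (max 0 (g x)) \<partial>Q)"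
    using g by (subst nn_integral_eq_integral) (auto simp: integral_nonneg)
  also have "\<dots> \<le> enn2ereal (\<integral>\<^sup>+ x. e2ennreal (u x) \<partial>Q)"
    unfolding less_eq_ennreal.rep_eq[symmetric]
  proof (intro nn_integral_mono_AE)
    show "AE x in Q. ennreal (max 0 (g x)) \<le> e2ennreal (u x)"
      using F(1)
    proof eventually_elim
      fix x assume x: "x \<in> Om"
      have "ereal (g x) \<le> u x"
        using s(2)[OF x] by (cases "c x") (auto simp: g_def u(3)[OF x])
      then have "ereal (max 0 (g x)) \<le> u x" using u(2)[of x] by (simp add: max_def zero_ereal_def)
      then show "ennreal (max 0 (g x)) \<le> e2ennreal (u x)" using e2ennreal_mono by fastforce
    qed
  qed
  finally have "ereal (integral\<^sup>L Q s + M * integral\<^sup>L Q w) \<le> enn2ereal (\<integral>\<^sup>+ x. e2ennreal (u x) \<partial>Q)"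
    unfolding g_def using F(2) F(3)[OF s(1)] by simp
  moreover have "ExpQ Q c = enn2ereal (\<integral>\<^sup>+ x. e2ennreal (u x) \<partial>Q) - ereal (M * integral\<^sup>L Q w)"
    by (rule ExpQ_shift[OF Q M u])
  ultimately show ?thesis
    by (cases "enn2ereal (\<integral>\<^sup>+ x. e2ennreal (u x) \<partial>Q)") auto
qed

section \<open>Weak duality and attainment\<close>

lemma integral_sum_Ecal:
  assumes "Q \<in> Prob1 d T K" "\<phi> \<in> Ecal T E"
  shows "integral\<^sup>L Q (\<lambda>x. \<Sum>t\<le>T. \<phi> t x) = (\<Sum>t\<le>T. integral\<^sup>L Q (\<phi> t))"
  using Prob1_facts(3)[OF assms(1)] Ecal_C[OF assms(2)] by (intro Bochner_Integration.integral_sum) auto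

text \<open>The choice \<phi> = 0 suffices; this keeps the dual expression free of infinity plus
  -infinity.\<close>

lemma Dcal_not_MInf: "Q \<in> Prob1 d T K \<Longrightarrow> Dcal T E U Q \<noteq> -\<infinity>"
proof -
  have "U (\<lambda>t x. 0) - ereal (\<Sum>t\<le>T. integral\<^sup>L Q (\<lambda>x. 0)) \<le> Dcal T E U Q"
    unfolding Dcal_def by (rule SUP_upper2[OF Ecal_zero]) simp
  then show ?thesis using U0 by (cases "U (\<lambda>t x. 0)") auto
qed

text \<open>Integrating the feasibility inequality against Q, with a having nonpositive integral,
  leaves (sum of the integrals of the \<psi>_t) - b <= E[c]; adding U(\<psi>) minus that sum, which
  is at most the penalty of Q, gives the bound.\<close>

lemma weak_duality:
  assumes Q: "Q \<in> Prob1 d T K \<inter> polarP A" and M: "0 \<le> M" and lsc: "lsc_on Om c"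
    and low: "\<forall>x\<in>Om. ereal (- M * w x) \<le> c x"
  shows "P c \<le> ExpQ Q c + Dcal T E U Q"
proof (rule P_least)
  fix \<psi> b a assume F: "feasible c \<psi> b a"
  have Q1: "Q \<in> Prob1 d T K" using Q by simp
  note facts = Prob1_facts[OF Q1]
  interpret prob_space Q by (rule facts)
  have \<psi>: "\<psi> \<in> Ecal T E" and a: "a \<in> A" using F by (auto simp: feasible_def)
  \<comment> \<open>The indicator makes s vanish off \<open>Om\<close>, as membership in
    \<open>C\<close> requires.\<close>
  define s where "s x = (\<Sum>t\<le>T. \<psi> t x) - b * indicator Om x - a x" for x
  have aC: "a \<in> C" using a Asub by blast
  have "(\<lambda>x. 1 * (1 * (\<Sum>t\<le>T. \<psi> t x) + (- b) * indicator Om x) + (-1) * a x) \<in> C"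
    by (intro Cspace_lin Ecal_sum_C \<psi> Cspace_indicator aC)
  then have sC: "s \<in> C" by (simp add: s_def[abs_def])
  have "ereal (integral\<^sup>L Q s) \<le> ExpQ Q c"
    using F by (intro integral_le_ExpQ[OF Q1 M lsc low sC]) (auto simp: s_def feasible_def)
  moreover have "(\<Sum>t\<le>T. integral\<^sup>L Q (\<psi> t)) - b \<le> integral\<^sup>L Q s"
  proof -
    have "integral\<^sup>L Q (indicat_real Om) = 1"
      using Q1 by (simp add: Prob1_def measure_def facts(7))
    moreover have "integral\<^sup>L Q a \<le> 0" using Q a by (auto simp: polarP_def)
    moreover have "integral\<^sup>L Q s = integral\<^sup>L Q (\<lambda>x. \<Sum>t\<le>T. \<psi> t x) - b * integral\<^sup>L Q (indicat_real Om) - integral\<^sup>L Q a"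
      unfolding s_def[abs_def]
      using facts(3)[OF Ecal_sum_C[OF \<psi>]] facts(3)[OF aC] facts(3)[OF Cspace_indicator] 
      by (subst Bochner_Integration.integral_diff, force, force, subst Bochner_Integration.integral_diff)
         (force simp del: Bochner_Integration.integral_indicator)+
    ultimately show ?thesis using integral_sum_Ecal[OF Q1 \<psi>] by simp
  qed
  ultimately have 1: "ereal ((\<Sum>t\<le>T. integral\<^sup>L Q (\<psi> t)) - b) \<le> ExpQ Q c"
    by (meson ereal_less_eq(3) order_trans)
  have "U \<psi> - ereal (\<Sum>t\<le>T. integral\<^sup>L Q (\<psi> t)) \<le> Dcal T E U Q"
    unfolding Dcal_def by (rule SUP_upper[OF \<psi>])
  with 1 Dcal_not_MInf[OF Q1] show "U \<psi> - ereal b \<le> ExpQ Q c + Dcal T E U Q"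
    by (cases "U \<psi>"; cases "ExpQ Q c"; cases "Dcal T E U Q") auto
qed

text \<open>If P(c + g) were infinite, then, since P(c - g) is not -infinity, the midpoint value
  P(c) would be infinite too. Thus P(c) - P(c + g) is a real convex function of g on all of
  \<open>C\<close> that vanishes at 0, a valid majorant for Hahn-Banach.\<close>

lemma supergradient:
  assumes low: "\<forall>x\<in>Om. ereal (- M * w x) \<le> c x" and fin: "P c < \<infinity>"
  shows "\<exists>L pc. P c = ereal pc \<and>
    (\<forall>g\<in>C. \<forall>h\<in>C. \<forall>a b. L (\<lambda>x. a * g x + b * h x) = a * L g + b * L h) \<and>
    (\<forall>g\<in>C. P (\<lambda>x. c x + ereal (g x)) \<le> ereal (pc + L g))"
proof -
  define G where "G g = real_of_ereal (P (\<lambda>x. c x + ereal (g x)))" for g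
  have comb: "ereal (l * s + (1 - l) * s') \<le> c x + ereal (l * g x + (1 - l) * g' x)"
    if "x \<in> Om" "ereal s \<le> c x + ereal (g x)" "ereal s' \<le> c x + ereal (g' x)" "0 < l" "l < 1" for x s s' g g' l
  proof (cases "c x")
    case (real r)
    have "l * s + (1 - l) * s' \<le> l * (r + g x) + (1 - l) * (r + g' x)"
      using that real by (intro add_mono mult_left_mono) auto
    then show ?thesis using real by (simp add: algebra_simps)
  qed (use low[rule_format, OF that(1)] in auto)
  have nMInf: "P (\<lambda>x. c x + ereal (g x)) \<noteq> -\<infinity>" if g: "g \<in> C" for g
  proof -
    obtain M' where M': "0 < M'" "\<And>x. x \<in> Om \<Longrightarrow> \<bar>g x\<bar> \<le> M' * w x" using C_bound[OF g] by blast
    show ?thesis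
    proof (rule P_lower[of "M + M'"])
      fix x assume x: "x \<in> Om"
      show "ereal (- (M + M') * w x) \<le> c x + ereal (g x)"
        using low[rule_format, OF x] M'(2)[OF x] by (cases "c x") (auto simp: algebra_simps)
    qed
  qed
  have G: "P (\<lambda>x. c x + ereal (g x)) = ereal (G g)" if g: "g \<in> C" for g
  proof -
    have "P (\<lambda>x. c x + ereal (g x)) \<noteq> \<infinity>"
    proof
      assume inf: "P (\<lambda>x. c x + ereal (g x)) = \<infinity>"
      have mg: "(\<lambda>x. - g x) \<in> C" using Cspace_lin[OF g g, of "-1" 0] by simp
      have "P c = \<infinity>"
      proof (rule P_infinite[OF inf nMInf[OF mg]])
        fix x s s' assume "x \<in> Om" "ereal s \<le> c x + ereal (g x)" "ereal s' \<le> c x + ereal (- g x)"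
        from comb[of x s g s' "\<lambda>x. - g x" "1/2", OF this] show "ereal (1/2 * s + 1/2 * s') \<le> c x" by (simp add: zero_ereal_def[symmetric])
      qed
      with fin show False by simp
    qed
    with nMInf[OF g] show ?thesis unfolding G_def by (cases "P (\<lambda>x. c x + ereal (g x))") auto
  qed
  have Pc: "P c = ereal (G (\<lambda>x. 0))"
    using G[OF Cspace_zero] by (simp add: zero_ereal_def[symmetric])
  have conc: "l * G g + (1 - l) * G g' \<le> G (\<lambda>x. l * g x + (1 - l) * g' x)"
    if "g \<in> C" "g' \<in> C" "0 < l" "l < 1" for g g' l
  proof -
    have "ereal (l * G g + (1 - l) * G g') \<le> P (\<lambda>x. c x + ereal (l * g x + (1 - l) * g' x))"
      by (rule P_concave[OF that(3,4) G[OF that(1)] G[OF that(2)]]) (use comb that in blast)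
    then show ?thesis using G[OF Cspace_lin[OF that(1,2)]] by simp
  qed
  obtain L where L: "\<And>g h a b. g \<in> C \<Longrightarrow> h \<in> C \<Longrightarrow> L (\<lambda>x. a * g x + b * h x) = a * L g + b * L h"
    "\<And>g. g \<in> C \<Longrightarrow> L g \<le> G (\<lambda>x. 0) - G g"
  proof (rule Hahn_Banach_convex[of C "\<lambda>g. G (\<lambda>x. 0) - G g"])
    show "G (\<lambda>x. 0) - G (\<lambda>x. l * g x + (1 - l) * h x) \<le> l * (G (\<lambda>x. 0) - G g) + (1 - l) * (G (\<lambda>x. 0) - G h)"
      if "g \<in> C" "h \<in> C" "0 < l" "l < 1" for g h l
      using conc[OF that] by (simp add: algebra_simps)
  qed (auto simp: Cspace_zero Cspace_lin)
  \<comment> \<open>Hahn-Banach bounds its functional by P(c) - P(c + g), so the supergradient is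
    its negative.\<close>
  show ?thesis
  proof (intro exI[of _ "\<lambda>g. - L g"] exI[of _ "G (\<lambda>x. 0)"] conjI ballI allI Pc)
    show "P (\<lambda>x. c x + ereal (g x)) \<le> ereal (G (\<lambda>x. 0) + - L g)" if "g \<in> C" for g
      using G[OF that] L(2)[OF that] by simp
  qed (simp add: L(1))
qed

lemma attained:
  assumes lsc: "lsc_on Om c" and M: "0 \<le> M"
    and low: "\<forall>x\<in>Om. ereal (- M * w x) \<le> c x" and fin: "P c < \<infinity>"
  shows "\<exists>Q\<in>Prob1 d T K \<inter> polarP A. ExpQ Q c + Dcal T E U Q \<le> P c"
proof -
  obtain L pc where Pc: "P c = ereal pc"
    and "\<forall>g\<in>C. \<forall>h\<in>C. \<forall>a b. L (\<lambda>x. a * g x + b * h x) = a * L g + b * L h"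
    and "\<forall>g\<in>C. P (\<lambda>x. c x + ereal (g x)) \<le> ereal (pc + L g)"
    using supergradient[OF low fin] by (elim exE conjE)
  note L_lin = this(2)[rule_format] and L_up = this(3)[rule_format]
  have L_scale: "L (\<lambda>x. a * g x) = a * L g" if "g \<in> C" for g a
    using L_lin[OF that that, of a 0] by simp
  have C_scale: "(\<lambda>x. a * g x) \<in> C" if "g \<in> C" for g a
    using Cspace_lin[OF that that, of a 0] by simp
  \<comment> \<open>The single source of positivity, normalisation and the sign on \<open>A\<close>:
    P(c) + k <= P(c + g) <= P(c) + L(g), with P(c) real.\<close>
  have transfer: "k \<le> L g"
    if g: "g \<in> C" and a: "a \<in> A" and le: "\<And>x. x \<in> Om \<Longrightarrow> k - a x \<le> g x" for g a k
  proof -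
    have "P c + ereal k \<le> P (\<lambda>x. c x + ereal (g x))"
    proof (rule P_transfer[OF a])
      fix x s assume "x \<in> Om" "ereal s \<le> c x"
      then show "ereal (s + k - a x) \<le> c x + ereal (g x)"
        using le[of x] by (cases "c x") auto
    qed
    also have "\<dots> \<le> ereal (pc + L g)" by (rule L_up[OF g])
    finally show ?thesis by (simp add: Pc)
  qed
  have L_pos: "0 \<le> L g" if "g \<in> C" "\<And>x. 0 \<le> g x" for g
    using transfer[OF that(1) A0, of 0] that(2) by simp
  \<comment> \<open>The bounds k = 1 for the unit and k = -1 for its negative give the two
    inequalities.\<close>
  have L_unit: "L (indicator Om) = 1"
    using transfer[OF C_scale[OF Cspace_indicator, of 1] A0, of 1]
      transfer[OF C_scale[OF Cspace_indicator, of "-1"] A0, of "-1"]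
      L_scale[OF Cspace_indicator, of "-1"] by simp
  have L_A: "L a \<le> 0" if "a \<in> A" for a
  proof -
    have aC: "a \<in> C" using that Asub by blast
    have "0 \<le> L (\<lambda>x. -1 * a x)"
      by (rule transfer[OF C_scale[OF aC] that]) simp
    then show ?thesis using L_scale[OF aC, of "-1"] by simp
  qed
  have L_mono: "L g \<le> L h" if "g \<in> C" "h \<in> C" "\<And>x. g x \<le> h x" for g h
    using L_pos[OF Cspace_lin[OF that(2,1), of 1 "-1"]] L_lin[OF that(2,1), of 1 "-1"] that(3) by simp
  \<comment> \<open>The supergradient inequality at g = (sum of the \<phi>_t) - h: as c - h >= 0,
    the triple with \<phi>, b = 0 and cone part 0 is feasible for c + g.\<close>
  have L_U: "U \<phi> \<le> ereal (pc + L (\<lambda>x. \<Sum>t\<le>T. \<phi> t x) - L h)"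
    if \<phi>: "\<phi> \<in> Ecal T E" and h: "h \<in> C" "\<And>x. x \<in> Om \<Longrightarrow> ereal (h x) \<le> c x" for \<phi> h
  proof -
    let ?g = "\<lambda>x. 1 * (\<Sum>t\<le>T. \<phi> t x) + (-1) * h x"
    have g: "?g \<in> C" by (intro Cspace_lin Ecal_sum_C \<phi> h)
    have "feasible (\<lambda>x. c x + ereal (?g x)) \<phi> 0 (\<lambda>x. 0)"
      unfolding feasible_def
    proof (intro conjI ballI)
      fix x assume "x \<in> Om"
      then show "ereal ((\<Sum>t\<le>T. \<phi> t x) - 0 - 0) \<le> c x + ereal (?g x)"
        using h(2)[of x] by (cases "c x") auto
    qed (use \<phi> A0 in auto)
    from P_upper[OF this] have "U \<phi> \<le> P (\<lambda>x. c x + ereal (?g x))" by (simp add: zero_ereal_def[symmetric])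
    also have "\<dots> \<le> ereal (pc + L ?g)" by (rule L_up[OF g])
    finally show ?thesis using L_lin[OF Ecal_sum_C[OF \<phi>] h(1), of 1 "-1"] by (simp add: add_diff_eq)
  qed
  define F where "F n x = (\<Sum>t\<le>T. f t n x)" for n x
  have F_pen: "F n = (\<lambda>x. -1 * (\<Sum>t\<le>T. penalty 1 n t x))" for n
    unfolding penalty_sum F_def by auto
  have F_C: "F n \<in> C" if "1 \<le> n" for n
    unfolding F_pen by (intro C_scale Ecal_sum_C penalty_Ecal that)
  have F_tight: "\<exists>n\<ge>1. L (F n) \<le> e" if e: "0 < e" for e
  proof -
    define h where "h = (\<lambda>x. - M * (indicator Om x * w x))"
    have h: "h \<in> C" "\<And>x. x \<in> Om \<Longrightarrow> ereal (h x) \<le> c x"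
      unfolding h_def using C_scale[OF C_w, of "- M"] low by auto
    \<comment> \<open>Solved from \<Gamma> e = |pc - L h| + 1: \<open>L_U\<close> gives -1 < pc -
      \<Gamma> L(F n) - L h for large n, so L(F n) <= e.\<close>
    define \<Gamma> where "\<Gamma> = (\<bar>pc - L h\<bar> + 1) / e"
    have \<Gamma>: "0 < \<Gamma>" using e by (simp add: \<Gamma>_def add_pos_nonneg zero_less_divide_iff)
    have "\<forall>\<^sub>F n in sequentially. 1 \<le> n \<and> U (penalty \<Gamma> n) > ereal (-1)"
      using U_penalty[OF \<Gamma>] eventually_ge_at_top[of 1] by eventually_elim auto
    then obtain n where n: "1 \<le> n" "U (penalty \<Gamma> n) > ereal (-1)"
      by (auto simp: eventually_sequentially)
    have "L (\<lambda>x. \<Sum>t\<le>T. penalty \<Gamma> n t x) = - \<Gamma> * L (F n)"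
      unfolding penalty_sum using L_scale[OF F_C[OF n(1)], of "- \<Gamma>"] by (simp add: F_def)
    then have "ereal (-1) < ereal (pc - \<Gamma> * L (F n) - L h)"
      using L_U[OF penalty_Ecal[OF n(1)] h] n(2) by (metis less_le_trans add_uminus_conv_diff mult_minus_left)
    then have "\<Gamma> * L (F n) \<le> \<Gamma> * e" using e by (simp add: \<Gamma>_def)
    then show ?thesis using \<Gamma> n(1) by auto
  qed
  \<comment> \<open>First n is fixed by tightness, then Dini is used on the sublevel set belonging
    to it. Off the compact product g k <= g 0 <= B w <= B F n; on it g k < r/4. The two
    contributions to L(g k) add up to at most r/2.\<close>
  have L_cont: "(\<lambda>n. L (g n)) \<longlonglongrightarrow> 0"
    if g: "\<And>n. g n \<in> C" and decr: "\<And>n x. g (Suc n) x \<le> g n x" and lim: "\<And>x. (\<lambda>n. g n x) \<longlonglongrightarrow> 0" for g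
  proof (rule LIMSEQ_I)
    fix r :: real assume r: "0 < r"
    have dec: "decseq (\<lambda>n. g n x)" for x using decr by (intro decseq_SucI)
    have g0: "0 \<le> g n x" for n x using decseq_ge[OF dec[of x] lim[of x]] .
    obtain B where B: "0 < B" "\<And>x. x \<in> Om \<Longrightarrow> \<bar>g 0 x\<bar> \<le> B * w x"
      using C_bound[OF g[of 0]] by blast
    obtain n where n: "1 \<le> n" "L (F n) \<le> r / (4 * B)"
      using F_tight[of "r / (4 * B)"] B r by auto
    obtain R where R: "\<And>x. x \<in> Om \<Longrightarrow> \<forall>t\<le>T. (\<lambda>j. x (t, j)) \<in> KK t n \<Longrightarrow> absum d T x \<le> R"
      using compact_bound[OF n(1)] by blast
    obtain N where N: "\<And>k x. N \<le> k \<Longrightarrow> x \<in> {x \<in> Om. absum d T x \<le> R} \<Longrightarrow> g k x < r / 4"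
    proof (rule Dini_to_zero[OF compact_Omega_absum_le[OF Kclosed, of R], of g "r / 4"])
      show "continuous_on {x \<in> Om. absum d T x \<le> R} (g k)" for k
        using g[of k] by (auto simp: Cspace_T_iff intro: continuous_on_subset)
    qed (use decr lim r in auto)
    have "\<bar>L (g k)\<bar> < r" if k: "N \<le> k" for k
    proof -
      have "g k x \<le> B * F n x + r / 4 * indicator Om x" for x
      proof (cases "x \<in> Om")
        case True
        have F0: "0 \<le> F n x" unfolding F_def using fnonneg n True by (intro sum_nonneg) auto
        show ?thesis
        proof (cases "\<forall>t\<le>T. (\<lambda>j. x (t, j)) \<in> KK t n")
          case K: True
          then have "g k x < r / 4" using N[OF k] R[OF True] True by simp
          then show ?thesis using F0 B True by (simp add: add_increasing)
        next
          case False
          have "g k x \<le> g 0 x" using decseqD[OF dec, of 0 k] by simp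
          also have "\<dots> \<le> B * w x" using B(2)[OF True] by simp
          also have "\<dots> \<le> B * F n x"
            using fdom n True False B by (intro mult_left_mono) (auto simp: F_def w_def)
          finally show ?thesis using r True by simp
        qed
      next
        case False
        then show ?thesis using g[of k] F_C[OF n(1)] by (auto simp: Cspace_T_iff)
      qed
      then have "L (g k) \<le> B * L (F n) + r / 4 * L (indicator Om)"
        using L_mono[OF g Cspace_lin[OF F_C[OF n(1)] Cspace_indicator, of B "r / 4"], of k]
          L_lin[OF F_C[OF n(1)] Cspace_indicator, of B "r / 4"] by simp
      also have "\<dots> \<le> B * (r / (4 * B)) + r / 4" using n(2) B(1) L_unit by (simp add: mult_left_mono del: times_divide_eq_right)
      also have "\<dots> < r" using B(1) r by simp
      finally show ?thesis using L_pos[OF g g0, of k] by simp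
    qed
    then show "\<exists>no. \<forall>k\<ge>no. norm (L (g k) - 0) < r" by auto
  qed
  interpret D: daniell_functional C L Om
  proof
    show "\<And>f x. f \<in> C \<Longrightarrow> x \<notin> Om \<Longrightarrow> f x = 0" by (simp add: Cspace_T_iff)
    show "\<And>f. f \<in> C \<Longrightarrow> f \<in> borel_measurable borel" by (rule Cspace_measurable[OF closed_Om])
  qed (fact Cspace_lin Cspace_max Cspace_indicator Cspace_opens L_lin L_pos L_unit L_cont)+
  define Q where "Q = D.rep"
  have Q_int: "integrable Q g" "integral\<^sup>L Q g = L g" if "g \<in> C" for g
    using D.representation[OF that] by (simp_all add: Q_def)
  interpret prob_space Q unfolding Q_def by (rule D.prob_space_rep)
  have sQ [measurable_cong]: "sets Q = sets borel" and spQ: "space Q = UNIV" by (simp_all add: Q_def)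
  have QOm: "emeasure Q Om = 1" unfolding Q_def by (rule D.emeasure_rep_Om)
  have ae: "AE x in Q. x \<in> Om"
    using QOm closed_Om sQ by (intro AE_I_eq_1) (auto simp: spQ)
  have QP: "Q \<in> Prob1 d T K"
    unfolding Prob1_def
  proof (intro CollectI conjI allI impI ballI)
    fix t j assume tj: "t \<le> T" "j \<in> {1..d}"
    show "integrable Q (\<lambda>x. x (t, j))"
    proof (rule Bochner_Integration.integrable_bound[OF Q_int(1)[OF C_w]])
      have "(\<lambda>x. x (t, j)) \<in> borel_measurable borel"
        by (intro borel_measurable_continuous_onI) simp
      then show "(\<lambda>x. x (t, j)) \<in> borel_measurable Q"
        by (simp add: measurable_cong_sets[OF sQ refl])
      show "AE x in Q. norm (x (t, j)) \<le> norm (indicator Om x * w x)"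
        using ae
      proof eventually_elim
        fix x assume "x \<in> Om"
        then show "norm (x (t, j)) \<le> norm (indicator Om x * w x)"
          using coord_le_absum[OF tj, of x] by (simp add: w_def)
      qed
    qed
  qed (use prob_space_axioms sQ QOm in auto)
  have QA: "Q \<in> polarP A"
    unfolding polarP_def using Q_int(2) L_A Asub by auto
  have ne: "Om \<noteq> {}" using QOm by auto
  obtain v :: "nat \<Rightarrow> fn" where v: "\<And>n. v n \<in> C" "\<And>n x. 0 \<le> v n x" "\<And>n x. v n x \<le> v (Suc n) x"
    "\<And>x. x \<in> Om \<Longrightarrow> (SUP n. ereal (v n x)) = c x + ereal (M * w x)"
    using lsc_approximation[OF lsc low ne] by (elim exE conjE) blast
  define u where "u x = (SUP n. ereal (v n x))" for x
  note [measurable] = Cspace_measurable[OF closed_Om v(1)]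
  have u: "u \<in> borel_measurable borel" "\<And>x. 0 \<le> u x" "\<And>x. x \<in> Om \<Longrightarrow> u x = c x + ereal (M * w x)"
  proof -
    show "u \<in> borel_measurable borel" unfolding u_def[abs_def] by measurable
    show "0 \<le> u x" for x unfolding u_def using v(2) by (intro SUP_upper2[of 0]) auto
    show "u x = c x + ereal (M * w x)" if "x \<in> Om" for x unfolding u_def by (rule v(4)[OF that])
  qed
  define i where "i = M * integral\<^sup>L Q w"
  have wL: "integral\<^sup>L Q w = L (\<lambda>x. indicator Om x * w x)"
  proof -
    have "integral\<^sup>L Q w = integral\<^sup>L Q (\<lambda>x. indicator Om x * w x)"
    proof (rule integral_cong_AE)
      show "w \<in> borel_measurable Q"
        unfolding measurable_cong_sets[OF sQ refl] by (intro borel_measurable_continuous_onI continuous_on_w)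
      show "(\<lambda>x. indicator Om x * w x) \<in> borel_measurable Q"
        unfolding measurable_cong_sets[OF sQ refl] by (rule Cspace_measurable[OF closed_Om C_w])
      show "AE x in Q. w x = indicator Om x * w x" using ae by eventually_elim simp
    qed
    then show ?thesis using Q_int(2)[OF C_w] by simp
  qed
  \<comment> \<open>Removing the weight again gives minorants of c in \<open>C\<close> that increase
    to c on \<open>Om\<close>.\<close>
  define h where "h n = (\<lambda>x. 1 * v n x + (- M) * (indicator Om x * w x))" for n
  have h: "h n \<in> C" "L (h n) = L (v n) - i" for n
    unfolding h_def i_def wL using Cspace_lin[OF v(1) C_w, of 1 n "- M"] L_lin[OF v(1) C_w, of 1 n "- M"] by auto
  have h_le: "ereal (h n x) \<le> c x" if "x \<in> Om" for n x
  proof -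
    have "ereal (v n x) \<le> c x + ereal (M * w x)"
      unfolding v(4)[OF that, symmetric] by (rule SUP_upper) simp
    then show ?thesis using that by (cases "c x") (auto simp: h_def)
  qed
  have nn: "(\<integral>\<^sup>+ x. e2ennreal (u x) \<partial>Q) = (SUP n. ennreal (L (v n)))"
  proof -
    have mono: "mono (\<lambda>n. ereal (v n x))" for x using v(3) by (intro incseq_SucI) simp
    have "e2ennreal (u x) = (SUP n. ennreal (v n x))" for x
      unfolding u_def
      using sup_continuousD[OF sup_continuous_e2ennreal[OF sup_continuous_id] mono, of x] by simp
    then have "(\<integral>\<^sup>+ x. e2ennreal (u x) \<partial>Q) = (\<integral>\<^sup>+ x. (SUP n. ennreal (v n x)) \<partial>Q)" by simp
    also have "\<dots> = (SUP n. \<integral>\<^sup>+ x. ennreal (v n x) \<partial>Q)"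
      using v(3) by (intro nn_integral_monotone_convergence_SUP incseq_SucI) (auto simp: le_fun_def intro: ennreal_leI)
    also have "\<dots> = (SUP n. ennreal (L (v n)))"
      using v(2) Q_int[OF v(1)] by (subst nn_integral_eq_integral) auto
    finally show ?thesis .
  qed
  have Exp: "ExpQ Q c = enn2ereal (SUP n. ennreal (L (v n))) - ereal i"
    unfolding i_def nn[symmetric] by (rule ExpQ_shift[OF QP M u])
  \<comment> \<open>Monotone convergence in the form used below: a bound for all L(h n) is a bound
    for E[c].\<close>
  have Exp_le: "ExpQ Q c \<le> ereal b" if "\<And>n. L (h n) \<le> b" for b
  proof -
    have b: "L (v n) \<le> b + i" for n using that[of n] h(2)[of n] by simp
    have "0 \<le> L (v 0)" by (rule L_pos[OF v(1,2)])
    then have "0 \<le> b + i" using b[of 0] by simp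
    have "(SUP n. ennreal (L (v n))) \<le> ennreal (b + i)"
      using b by (intro SUP_least ennreal_leI)
    then have "enn2ereal (SUP n. ennreal (L (v n))) \<le> ereal (b + i)"
      using \<open>0 \<le> b + i\<close> by (simp add: less_eq_ennreal.rep_eq)
    then show ?thesis
      unfolding Exp by (cases "enn2ereal (SUP n. ennreal (L (v n)))") auto
  qed
  have hU: "L (h n) \<le> pc - r + L (\<lambda>x. \<Sum>t\<le>T. \<phi> t x)" if "\<phi> \<in> Ecal T E" "U \<phi> = ereal r" for n \<phi> r
    using L_U[OF that(1) h(1) h_le, of n] that(2) by simp
  obtain r0 where r0: "U (\<lambda>t x. 0) = ereal r0"
    using U0 Ufin Ecal_zero by (cases "U (\<lambda>t x. 0)") auto
  \<comment> \<open>The choice \<phi> = 0 bounds E[c] above and nonnegativity of u bounds it below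
    by -i; it has to be real to be subtracted from pc.\<close>
  have "ExpQ Q c \<le> ereal (pc - r0 + L (\<lambda>x. \<Sum>t\<le>T. 0))"
    by (rule Exp_le[OF hU[OF Ecal_zero r0]])
  moreover have "ereal (- i) \<le> ExpQ Q c"
  proof -
    have "ereal (- i) \<le> y - ereal i" if "0 \<le> y" for y using that by (cases y) auto
    then show ?thesis unfolding Exp by simp
  qed
  ultimately obtain e where e: "ExpQ Q c = ereal e" by (cases "ExpQ Q c") auto
  have "Dcal T E U Q \<le> ereal (pc - e)"
    unfolding Dcal_def
  proof (rule SUP_least)
    fix \<phi> assume \<phi>: "\<phi> \<in> Ecal T E"
    have S: "(\<Sum>t\<le>T. integral\<^sup>L Q (\<phi> t)) = L (\<lambda>x. \<Sum>t\<le>T. \<phi> t x)"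
      using integral_sum_Ecal[OF QP \<phi>] Q_int(2)[OF Ecal_sum_C[OF \<phi>]] by simp
    show "U \<phi> - ereal (\<Sum>t\<le>T. integral\<^sup>L Q (\<phi> t)) \<le> ereal (pc - e)"
    proof (cases "U \<phi>")
      case (real r)
      have "e \<le> pc - r + L (\<lambda>x. \<Sum>t\<le>T. \<phi> t x)"
        using Exp_le[OF hU[OF \<phi> real]] e by simp
      then show ?thesis using real S by simp
    qed (use Ufin \<phi> in auto)
  qed
  then have "ExpQ Q c + Dcal T E U Q \<le> P c"
    unfolding e Pc by (cases "Dcal T E U Q") auto
  then show ?thesis using QP QA by blast
qed

section \<open>Finiteness and continuity on B_{0:T}\<close>

lemma normB_less:
  assumes "normB d T K c < ereal \<delta>" "x \<in> Om" shows "\<bar>c x\<bar> \<le> \<delta> * w x"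
proof -
  have "ereal (\<bar>c x\<bar> / w x) \<le> normB d T K c"
    unfolding normB_def w_def by (rule SUP_upper[OF assms(2)])
  also have "\<dots> < ereal \<delta>" by (rule assms)
  finally show ?thesis using w_ge_1[of x] by (simp add: divide_less_eq)
qed

lemma Bspace_bound:
  assumes "c \<in> Bspace d T K"
  shows "\<exists>M. \<forall>x\<in>Om. \<bar>c x\<bar> \<le> M * w x"
proof -
  have "normB d T K c \<noteq> \<infinity>" using assms by (auto simp: Bspace_def)
  then obtain n :: nat where "normB d T K c < ereal (real n)"
    by (metis less_PInf_Ex_of_nat)
  then show ?thesis using normB_less by blast
qed

lemma P_real_combine:
  assumes l: "0 < l" "l < 1" and r: "P (\<lambda>x. ereal (c x)) = ereal r" "P (\<lambda>x. ereal (c' x)) = ereal r'"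
    and le: "\<And>x. x \<in> Om \<Longrightarrow> l * c x + (1 - l) * c' x \<le> c'' x"
  shows "ereal (l * r + (1 - l) * r') \<le> P (\<lambda>x. ereal (c'' x))"
proof (rule P_concave[OF l r])
  fix x s s' assume x: "x \<in> Om" and "ereal s \<le> ereal (c x)" "ereal s' \<le> ereal (c' x)"
  then have "l * s + (1 - l) * s' \<le> l * c x + (1 - l) * c' x"
    using l by (intro add_mono mult_left_mono) auto
  with le[OF x] show "ereal (l * s + (1 - l) * s') \<le> ereal (c'' x)" by simp
qed

lemma P_not_MInf:
  assumes "\<exists>M. \<forall>x\<in>Om. \<bar>c x\<bar> \<le> M * w x" shows "P (\<lambda>x. ereal (c x)) \<noteq> -\<infinity>"
proof -
  obtain M where M: "\<forall>x\<in>Om. \<bar>c x\<bar> \<le> M * w x" using assms ..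
  show ?thesis by (rule P_lower[of M]) (use M in force)
qed

text \<open>\<open>ch\<close> is the midpoint of c and its reflection 2 ch - c, whose value is not
  -infinity, so an infinite value at c would make the value at \<open>ch\<close> infinite.\<close>

lemma P_finite:
  assumes ch: "\<exists>M. \<forall>x\<in>Om. \<bar>ch x\<bar> \<le> M * w x" "P (\<lambda>x. ereal (ch x)) < \<infinity>"
    and c: "\<exists>M. \<forall>x\<in>Om. \<bar>c x\<bar> \<le> M * w x"
  shows "\<exists>r. P (\<lambda>x. ereal (c x)) = ereal r"
proof -
  obtain M where M: "\<forall>x\<in>Om. \<bar>c x\<bar> \<le> M * w x" using c ..
  obtain M' where M': "\<forall>x\<in>Om. \<bar>ch x\<bar> \<le> M' * w x" using ch(1) ..
  have "\<bar>2 * ch x - c x\<bar> \<le> (2 * M' + M) * w x" if "x \<in> Om" for x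
    using M[rule_format, OF that] M'[rule_format, OF that] by (simp add: algebra_simps abs_le_iff)
  then have refl: "P (\<lambda>x. ereal (2 * ch x - c x)) \<noteq> -\<infinity>" by (intro P_not_MInf) blast
  have "P (\<lambda>x. ereal (c x)) \<noteq> \<infinity>"
  proof
    assume "P (\<lambda>x. ereal (c x)) = \<infinity>"
    then have "P (\<lambda>x. ereal (ch x)) = \<infinity>" by (rule P_infinite[OF _ refl]) simp
    with ch(2) show False by simp
  qed
  with P_not_MInf[OF c] show ?thesis by (cases "P (\<lambda>x. ereal (c x))") auto
qed

lemma P_cash: "P (\<lambda>x. ereal (c x + k)) = P (\<lambda>x. ereal (c x)) + ereal k"
proof (rule antisym)
  have "P (\<lambda>x. ereal (c x + k)) + ereal (- k) \<le> P (\<lambda>x. ereal (c x))"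
    by (rule P_transfer[OF A0]) simp
  then show "P (\<lambda>x. ereal (c x + k)) \<le> P (\<lambda>x. ereal (c x)) + ereal k"
    by (cases "P (\<lambda>x. ereal (c x + k))"; cases "P (\<lambda>x. ereal (c x))") auto
  show "P (\<lambda>x. ereal (c x)) + ereal k \<le> P (\<lambda>x. ereal (c x + k))"
    by (rule P_transfer[OF A0]) simp
qed

text \<open>Concavity along the direction w controls both sides: the decrease p - m from c to c - w
  bounds the change at distance \<delta> by \<delta> (p - m), and c' >= c - \<delta> w is a convex
  combination of c and c - w.\<close>

lemma P_continuous:
  assumes fin: "\<And>c. \<exists>M. \<forall>x\<in>Om. \<bar>c x\<bar> \<le> M * w x \<Longrightarrow> \<exists>r. P (\<lambda>x. ereal (c x)) = ereal r"
    and c: "\<exists>M. \<forall>x\<in>Om. \<bar>c x\<bar> \<le> M * w x" and e: "0 < e"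
  shows "\<exists>\<delta>>0. \<forall>c'. (\<exists>M. \<forall>x\<in>Om. \<bar>c' x\<bar> \<le> M * w x) \<longrightarrow> (\<forall>x\<in>Om. \<bar>c' x - c x\<bar> \<le> \<delta> * w x) \<longrightarrow>
    \<bar>real_of_ereal (P (\<lambda>x. ereal (c' x))) - real_of_ereal (P (\<lambda>x. ereal (c x)))\<bar> < e"
proof -
  obtain M where M: "\<forall>x\<in>Om. \<bar>c x\<bar> \<le> M * w x" using c ..
  obtain p where p: "P (\<lambda>x. ereal (c x)) = ereal p" using fin[OF c] ..
  have "\<bar>c x - w x\<bar> \<le> (M + 1) * w x" if "x \<in> Om" for x
    using M[rule_format, OF that] w_ge_1[of x] by (simp add: algebra_simps abs_le_iff)
  then obtain m where m: "P (\<lambda>x. ereal (c x - w x)) = ereal m" using fin[of "\<lambda>x. c x - w x"] by blast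
  \<comment> \<open>At most 1/2, so that it is a convex weight; the added 1 avoids division by zero
    when p = m.\<close>
  define \<delta> where "\<delta> = min (1/2) (e / (2 * (\<bar>p - m\<bar> + 1)))"
  have \<delta>: "0 < \<delta>" "\<delta> < 1" using e by (auto simp: \<delta>_def intro!: divide_pos_pos add_nonneg_pos)
  have small: "\<delta> * \<bar>p - m\<bar> < e"
  proof -
    have "\<delta> * \<bar>p - m\<bar> \<le> e / (2 * (\<bar>p - m\<bar> + 1)) * (\<bar>p - m\<bar> + 1)"
      using \<delta> e by (intro mult_mono) (auto simp: \<delta>_def)
    also have "\<dots> = e / 2" by (simp add: field_simps add_nonneg_eq_0_iff)
    finally show ?thesis using e by simp
  qed
  show ?thesis
  proof (intro exI[of _ \<delta>] conjI allI impI \<delta>(1))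
    fix c' assume c': "\<exists>M. \<forall>x\<in>Om. \<bar>c' x\<bar> \<le> M * w x" and near: "\<forall>x\<in>Om. \<bar>c' x - c x\<bar> \<le> \<delta> * w x"
    obtain r where r: "P (\<lambda>x. ereal (c' x)) = ereal r" using fin[OF c'] ..
    have "ereal (\<delta> * m + (1 - \<delta>) * p) \<le> P (\<lambda>x. ereal (c' x))"
    proof (rule P_real_combine[OF \<delta> m p])
      fix x assume "x \<in> Om"
      then have "\<bar>c' x - c x\<bar> \<le> \<delta> * w x" using near by blast
      then show "\<delta> * (c x - w x) + (1 - \<delta>) * c x \<le> c' x" by (simp add: algebra_simps)
    qed
    then have 1: "p - \<delta> * (p - m) \<le> r" using r by (simp add: algebra_simps)
    \<comment> \<open>For the upper bound c has to dominate l c' + (1 - l)(c - w); with c' <= c +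
      \<delta> w this holds when 1 - l = l \<delta>.\<close>
    define l where "l = 1 / (1 + \<delta>)"
    have l: "0 < l" "l < 1" "1 - l = l * \<delta>" "(1 + \<delta>) * l = 1"
      using \<delta> by (auto simp: l_def field_simps)
    have "ereal (l * r + (1 - l) * m) \<le> P (\<lambda>x. ereal (c x))"
    proof (rule P_real_combine[OF l(1,2) r m])
      fix x assume "x \<in> Om"
      then have "c' x \<le> c x + \<delta> * w x" using near by (auto simp: abs_le_iff algebra_simps)
      then have "l * c' x + (1 - l) * (c x - w x) \<le> l * (c x + \<delta> * w x) + (1 - l) * (c x - w x)"
        using l by simp
      also have "\<dots> = c x + (l * \<delta> - (1 - l)) * w x" by (simp add: algebra_simps)
      also have "\<dots> = c x" using l(3) by simp
      finally show "l * c' x + (1 - l) * (c x - w x) \<le> c x" .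
    qed
    then have "l * (r + \<delta> * m) \<le> p" using p l(3) by (simp add: algebra_simps)
    then have "(1 + \<delta>) * (l * (r + \<delta> * m)) \<le> (1 + \<delta>) * p" using \<delta> by (intro mult_left_mono) auto
    then have "r + \<delta> * m \<le> (1 + \<delta>) * p" using l(4) by (metis mult.assoc mult_1)
    then have "r \<le> p + \<delta> * (p - m)" by (simp add: algebra_simps)
    moreover have "\<delta> * (p - m) \<le> \<delta> * \<bar>p - m\<bar>" using \<delta> by (intro mult_left_mono) auto
    ultimately show "\<bar>real_of_ereal (P (\<lambda>x. ereal (c' x))) - real_of_ereal (P (\<lambda>x. ereal (c x)))\<bar> < e"
      using 1 small p r by (simp add: abs_less_iff)
  qed
qed

section \<open>The two forms of the dual penalty, and the duality formula\<close>

lemma Dcal_eq_V: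
  "Dcal T E U Q = (SUP \<phi>\<in>Ecal T E. ereal (\<Sum>t\<le>T. integral\<^sup>L Q (\<phi> t)) - Vfun U \<phi>)"
proof -
  have flip: "ereal (\<Sum>t\<le>T. integral\<^sup>L Q (\<lambda>x. - \<phi> t x)) - Vfun U (\<lambda>t x. - \<phi> t x)
      = U \<phi> - ereal (\<Sum>t\<le>T. integral\<^sup>L Q (\<phi> t))" for \<phi>
    by (cases "U \<phi>") (auto simp: Vfun_def sum_negf)
  show ?thesis
    unfolding Dcal_def
  proof (rule SUP_eq)
    show "\<exists>j\<in>Ecal T E. U \<phi> - ereal (\<Sum>t\<le>T. integral\<^sup>L Q (\<phi> t)) \<le> ereal (\<Sum>t\<le>T. integral\<^sup>L Q (j t)) - Vfun U j"
      if "\<phi> \<in> Ecal T E" for \<phi>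
      using flip[of \<phi>] by (intro bexI[OF _ Ecal_uminus[OF that]]) simp
    show "\<exists>i\<in>Ecal T E. ereal (\<Sum>t\<le>T. integral\<^sup>L Q (\<phi> t)) - Vfun U \<phi> \<le> U i - ereal (\<Sum>t\<le>T. integral\<^sup>L Q (i t))"
      if "\<phi> \<in> Ecal T E" for \<phi>
      using flip[of "\<lambda>t x. - \<phi> t x"] by (intro bexI[OF _ Ecal_uminus[OF that]]) simp
  qed
qed

lemma duality:
  assumes lsc: "lsc_on Om c" and M: "0 \<le> M" and low: "\<forall>x\<in>Om. ereal (- M * w x) \<le> c x"
  shows "P c = (INF Q\<in>Prob1 d T K \<inter> polarP A. ExpQ Q c + Dcal T E U Q)"
    and "P c < \<infinity> \<Longrightarrow> \<exists>Q\<in>Prob1 d T K \<inter> polarP A. P c = ExpQ Q c + Dcal T E U Q"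
proof -
  have weak: "P c \<le> ExpQ Q c + Dcal T E U Q" if "Q \<in> Prob1 d T K \<inter> polarP A" for Q
    by (rule weak_duality[OF that M lsc low])
  show att: "\<exists>Q\<in>Prob1 d T K \<inter> polarP A. P c = ExpQ Q c + Dcal T E U Q" if "P c < \<infinity>"
    using attained[OF lsc M low that] weak by (meson antisym)
  show "P c = (INF Q\<in>Prob1 d T K \<inter> polarP A. ExpQ Q c + Dcal T E U Q)"
  proof (rule antisym)
    show "P c \<le> (INF Q\<in>Prob1 d T K \<inter> polarP A. ExpQ Q c + Dcal T E U Q)"
      using weak by (rule INF_greatest)
    show "(INF Q\<in>Prob1 d T K \<inter> polarP A. ExpQ Q c + Dcal T E U Q) \<le> P c"
    proof (cases "P c < \<infinity>")
      case True
      from att[OF this] obtain Q where Q: "Q \<in> Prob1 d T K \<inter> polarP A" "P c = ExpQ Q c + Dcal T E U Q" ..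
      then show ?thesis by (intro INF_lower2[OF Q(1)]) simp
    qed simp
  qed
qed

end

theorem theorem2p11:
  fixes d T :: nat
    and K :: "nat \<Rightarrow> nat \<Rightarrow> real set"
    and E :: "nat \<Rightarrow> fn set"
    and U :: "(nat \<Rightarrow> fn) \<Rightarrow> ereal"
    and A :: "fn set"
    and KK :: "nat \<Rightarrow> nat \<Rightarrow> (nat \<Rightarrow> real) set"
    and f :: "nat \<Rightarrow> nat \<Rightarrow> fn"
  defines "Om \<equiv> Omega d T K"
  assumes d1: "1 \<le> d" and T1: "1 \<le> T"
    and Kclosed: "\<forall>t\<le>T. \<forall>j\<in>{1..d}. closed (K t j)"
    \<comment> \<open>E_t vector subspaces with R \<subseteq> E_t \<subseteq> C_{0:t}\<close>
    and Esub: "\<forall>t\<le>T. E t \<subseteq> Cspace d T K t"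
    and Eadd: "\<forall>t\<le>T. \<forall>\<phi>\<in>E t. \<forall>\<psi>\<in>E t. (\<lambda>x. \<phi> x + \<psi> x) \<in> E t"
    and Esmult: "\<forall>t\<le>T. \<forall>\<phi>\<in>E t. \<forall>r::real. (\<lambda>x. r * \<phi> x) \<in> E t"
    and Econst: "\<forall>t\<le>T. \<forall>k::real. cst Om k \<in> E t"
    \<comment> \<open>U : \<E> \<rightarrow> [-\<infinity>,+\<infinity>), concave, U(0) real\<close>
    and Ufin: "\<forall>\<phi>\<in>Ecal T E. U \<phi> < \<infinity>"
    and Uconc: "\<forall>\<phi>\<in>Ecal T E. \<forall>\<psi>\<in>Ecal T E. \<forall>l\<in>{0<..<(1::real)}.
                  ereal l * U \<phi> + ereal (1 - l) * U \<psi>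
                  \<le> U (\<lambda>t x. l * \<phi> t x + (1 - l) * \<psi> t x)"
    and U0: "U (\<lambda>t x. 0) \<noteq> -\<infinity>"
    \<comment> \<open>\<A> \<subseteq> C_{0:T} convex cone containing 0\<close>
    and Asub: "A \<subseteq> Cspace d T K T"
    and A0: "(\<lambda>x. 0) \<in> A"
    and Acone: "\<forall>a\<in>A. \<forall>b\<in>A. \<forall>r\<ge>0. \<forall>s\<ge>0. (\<lambda>x. r * a x + s * b x) \<in> A"
    \<comment> \<open>assumption (ii)\<close>
    and KKsub: "\<forall>t\<le>T. \<forall>n\<ge>1. KK t n \<subseteq>
                  {y. (\<forall>j\<in>{1..d}. y j \<in> K t j) \<and> (\<forall>j. j \<notin> {1..d} \<longrightarrow> y j = 0)}"
    and KKcompact: "\<forall>t\<le>T. \<forall>n\<ge>1. compact (KK t n)"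
    and fE: "\<forall>t\<le>T. \<forall>n\<ge>1. f t n \<in> E t"
    and fnonneg: "\<forall>t\<le>T. \<forall>n\<ge>1. \<forall>x\<in>Om. 0 \<le> f t n x"
    and fdom: "\<forall>n\<ge>1. \<forall>x\<in>Om. \<not> (\<forall>t\<le>T. (\<lambda>j. x (t,j)) \<in> KK t n) \<longrightarrow>
                  1 + absum d T x \<le> (\<Sum>t\<le>T. f t n x)"
    and fV: "\<forall>\<Gamma>>0. (\<lambda>n. Vfun U (\<lambda>t. if t \<le> T then (\<lambda>x. \<Gamma> * f t n x) else (\<lambda>x. 0)))
                  \<longlonglongrightarrow> 0"
  shows
    "((\<exists>ch\<in>Bspace d T K. Pfrak T Om E U A (\<lambda>x. ereal (ch x)) < \<infinity>) \<longrightarrow>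
        (\<forall>c\<in>Bspace d T K. Pfrak T Om E U A (\<lambda>x. ereal (c x)) \<noteq> \<infinity> \<and> Pfrak T Om E U A (\<lambda>x. ereal (c x)) \<noteq> -\<infinity>)
      \<and> (\<forall>c\<in>Bspace d T K. \<forall>\<epsilon>>0. \<exists>\<delta>>0. \<forall>c'\<in>Bspace d T K.
           normB d T K (\<lambda>x. c' x - c x) < ereal \<delta> \<longrightarrow>
           \<bar>real_of_ereal (Pfrak T Om E U A (\<lambda>x. ereal (c' x)))
             - real_of_ereal (Pfrak T Om E U A (\<lambda>x. ereal (c x)))\<bar> < \<epsilon>)
      \<and> (\<forall>c\<in>Bspace d T K. \<forall>k::real.
           Pfrak T Om E U A (\<lambda>x. ereal (c x + k)) = Pfrak T Om E U A (\<lambda>x. ereal (c x)) + ereal k)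
      \<and> (\<forall>c\<in>Bspace d T K. \<forall>c'\<in>Bspace d T K. \<forall>l\<in>{0..(1::real)}.
           ereal l * Pfrak T Om E U A (\<lambda>x. ereal (c x))
             + ereal (1 - l) * Pfrak T Om E U A (\<lambda>x. ereal (c' x))
           \<le> Pfrak T Om E U A (\<lambda>x. ereal (l * c x + (1 - l) * c' x)))
      \<and> (\<forall>c\<in>Bspace d T K. \<forall>c'\<in>Bspace d T K. (\<forall>x\<in>Om. c x \<le> c' x) \<longrightarrow>
           Pfrak T Om E U A (\<lambda>x. ereal (c x)) \<le> Pfrak T Om E U A (\<lambda>x. ereal (c' x))))
     \<and> (\<forall>Q\<in>Prob1 d T K. Dcal T E U Q =
           (SUP \<phi>\<in>Ecal T E. ereal (\<Sum>t\<le>T. integral\<^sup>L Q (\<phi> t)) - Vfun U \<phi>))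
     \<and> (\<forall>c::pt \<Rightarrow> ereal. \<forall>Acst::real.
          lsc_on Om c \<and> 0 \<le> Acst \<and> (\<forall>x\<in>Om. c x \<noteq> -\<infinity>) \<and>
          (\<forall>x\<in>Om. ereal (- Acst * (1 + absum d T x)) \<le> c x) \<longrightarrow>
            Pfrak T Om E U A c =
              (INF Q\<in>Prob1 d T K \<inter> polarP A. ExpQ Q c + Dcal T E U Q)
          \<and> (Pfrak T Om E U A c < \<infinity> \<longrightarrow>
              (\<exists>Q\<in>Prob1 d T K \<inter> polarP A. Pfrak T Om E U A c = ExpQ Q c + Dcal T E U Q)))"
proof -
  interpret superhedging d T K E U A KK f
    by (rule superhedging.intro[OF Kclosed Esub Eadd Esmult Econst[unfolded Om_def] Ufin Uconc U0 Asub
          A0 Acone KKcompact fE fnonneg[unfolded Om_def] fdom[unfolded Om_def] fV])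
  have OmE: "Om = Omega d T K" by (simp add: Om_def)
  note bound = Bspace_bound
  show ?thesis
    unfolding OmE
  proof (intro conjI impI ballI allI)
    assume ex: "\<exists>ch\<in>Bspace d T K. P (\<lambda>x. ereal (ch x)) < \<infinity>"
    have fin: "\<exists>r. P (\<lambda>x. ereal (c x)) = ereal r" if "\<exists>M. \<forall>x\<in>Omega d T K. \<bar>c x\<bar> \<le> M * w x" for c
      using ex P_finite[OF bound _ that] by blast
    show "P (\<lambda>x. ereal (c x)) \<noteq> \<infinity>" "P (\<lambda>x. ereal (c x)) \<noteq> -\<infinity>" if "c \<in> Bspace d T K" for c
      using fin[OF bound[OF that]] by auto
    show "\<exists>\<delta>>0. \<forall>c'\<in>Bspace d T K. normB d T K (\<lambda>x. c' x - c x) < ereal \<delta> \<longrightarrow>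
        \<bar>real_of_ereal (P (\<lambda>x. ereal (c' x))) - real_of_ereal (P (\<lambda>x. ereal (c x)))\<bar> < e"
      if cB: "c \<in> Bspace d T K" and e: "0 < e" for c e
    proof -
      obtain \<delta> where \<delta>: "0 < \<delta>" "\<forall>c'. (\<exists>M. \<forall>x\<in>Omega d T K. \<bar>c' x\<bar> \<le> M * w x) \<longrightarrow>
          (\<forall>x\<in>Omega d T K. \<bar>c' x - c x\<bar> \<le> \<delta> * w x) \<longrightarrow>
          \<bar>real_of_ereal (P (\<lambda>x. ereal (c' x))) - real_of_ereal (P (\<lambda>x. ereal (c x)))\<bar> < e"
        using P_continuous[OF fin bound[OF cB] e] by blast
      show ?thesis
      proof (intro exI[of _ \<delta>] conjI ballI impI \<delta>(1))
        fix c' assume "c' \<in> Bspace d T K" "normB d T K (\<lambda>x. c' x - c x) < ereal \<delta>"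
        then show "\<bar>real_of_ereal (P (\<lambda>x. ereal (c' x))) - real_of_ereal (P (\<lambda>x. ereal (c x)))\<bar> < e"
          using \<delta>(2)[rule_format, OF bound] normB_less by blast
      qed
    qed
    show "ereal l * P (\<lambda>x. ereal (c x)) + ereal (1 - l) * P (\<lambda>x. ereal (c' x))
        \<le> P (\<lambda>x. ereal (l * c x + (1 - l) * c' x))"
      if cc: "c \<in> Bspace d T K" "c' \<in> Bspace d T K" and l: "l \<in> {0..1}" for c c' l
    proof -
      obtain r where r: "P (\<lambda>x. ereal (c x)) = ereal r" using fin[OF bound[OF cc(1)]] ..
      obtain r' where r': "P (\<lambda>x. ereal (c' x)) = ereal r'" using fin[OF bound[OF cc(2)]] ..
      consider "l = 0" | "l = 1" | "0 < l" "l < 1" using l by force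
      then show ?thesis
      proof cases
        case 3
        then show ?thesis using P_real_combine[OF 3 r r'] by (simp add: r r')
      qed (simp_all add: r r')
    qed
  next
    show "P (\<lambda>x. ereal (c x + k)) = P (\<lambda>x. ereal (c x)) + ereal k" for c k
      by (rule P_cash)
    show "P (\<lambda>x. ereal (c x)) \<le> P (\<lambda>x. ereal (c' x))" if "\<forall>x\<in>Omega d T K. c x \<le> c' x" for c c'
      using that by (intro P_mono) simp
    show "Dcal T E U Q = (SUP \<phi>\<in>Ecal T E. ereal (\<Sum>t\<le>T. integral\<^sup>L Q (\<phi> t)) - Vfun U \<phi>)" for Q
      by (rule Dcal_eq_V)
  next
    fix c :: "pt \<Rightarrow> ereal" and Acst :: real
    assume "lsc_on (Omega d T K) c \<and> 0 \<le> Acst \<and> (\<forall>x\<in>Omega d T K. c x \<noteq> -\<infinity>) \<and>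
      (\<forall>x\<in>Omega d T K. ereal (- Acst * (1 + absum d T x)) \<le> c x)"
    then have *: "lsc_on (Omega d T K) c" "0 \<le> Acst" "\<forall>x\<in>Omega d T K. ereal (- Acst * w x) \<le> c x"
      by (auto simp: w_def)
    show "P c = (INF Q\<in>Prob1 d T K \<inter> polarP A. ExpQ Q c + Dcal T E U Q)"
      by (rule duality(1)[OF *])
    show "\<exists>Q\<in>Prob1 d T K \<inter> polarP A. P c = ExpQ Q c + Dcal T E U Q" if "P c < \<infinity>"
      by (rule duality(2)[OF * that])
  qed
qed

end
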